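(* Let $\alpha=\tfrac12(\sqrt5-1)$ and $\theta\in[0,1)$, and let $J$ be the half-line Jacobi matrix with $a_n=1$ and $b_n=\chi_{[1-\alpha,1)}\big((n\alpha+\theta)\bmod 1\big)$ for $n\ge1$ (a Fibonacci model restricted to a half-line). Then $\sup_{x_0\in\sigma(J)}p_n(x_0)^2/K_n(x_0,x_0)\to0$ as $n\to\infty$; i.e. the Nevai condition holds uniformly on the spectrum of $J$.
   Context: $\chi_I$ denotes the characteristic function of $I$. The half-line Jacobi matrix $J$ acts on $\ell^2(\{1,2,\dots\})$ by $J_{nn}=b_n$, $J_{n,n+1}=J_{n+1,n}=a_n$; $\rho$ is its spectral measure for $\delta_1$, $p_n$ its orthonormal polynomials ($p_{-1}=0$, $p_0=1$, $xp_n=a_{n+1}p_{n+1}+b_{n+1}p_n+a_np_{n-1}$), and $K_n(x,y)=\sum_{j=0}^np_j(x)p_j(y)$. The Nevai condition at $x_0$ means $K_n(x,x_0)^2d\rho(x)/K_n(x_0,x_0)\to\delta_{x_0}$ weakly. *)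

theory Defs
  imports "HOL-Analysis.Analysis"
begin

text \<open>Half-line Jacobi matrix with off-diagonal a n (n \<ge> 1) and diagonal b n (n \<ge> 1).
  Vectors in ell^2({1,2,...}) are represented as u :: nat \<Rightarrow> real with u k the
  (k+1)-th component (0-based storage).\<close>

definition ell2 :: "(nat \<Rightarrow> real) set" where
  "ell2 = {u. summable (\<lambda>k. (u k)\<^sup>2)}"

definition jacobi_op :: "(nat \<Rightarrow> real) \<Rightarrow> (nat \<Rightarrow> real) \<Rightarrow> (nat \<Rightarrow> real) \<Rightarrow> (nat \<Rightarrow> real)" where
  "jacobi_op a b u = (\<lambda>k. a (k+1) * u (k+1) + b (k+1) * u k
                          + (if k = 0 then 0 else a k * u (k - 1)))"

text \<open>Spectrum: z is in the resolvent set iff J - z is a bijection of ell^2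
  (bounded inverse is automatic by the open mapping theorem).\<close>
definition jacobi_spectrum :: "(nat \<Rightarrow> real) \<Rightarrow> (nat \<Rightarrow> real) \<Rightarrow> real set" where
  "jacobi_spectrum a b =
     {x. \<not> bij_betw (\<lambda>u. (\<lambda>k. jacobi_op a b u k - x * u k)) ell2 ell2}"

text \<open>Orthonormal polynomials: p_{-1} = 0, p_0 = 1,
  x p_n = a_{n+1} p_{n+1} + b_{n+1} p_n + a_n p_{n-1}.\<close>
fun opoly :: "(nat \<Rightarrow> real) \<Rightarrow> (nat \<Rightarrow> real) \<Rightarrow> nat \<Rightarrow> real \<Rightarrow> real" where
  "opoly a b 0 x = 1"
| "opoly a b (Suc 0) x = (x - b 1) / a 1"
| "opoly a b (Suc (Suc n)) x =
     ((x - b (n + 2)) * opoly a b (Suc n) x - a (n + 1) * opoly a b n x) / a (n + 2)"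

definition CD_kernel :: "(nat \<Rightarrow> real) \<Rightarrow> (nat \<Rightarrow> real) \<Rightarrow> nat \<Rightarrow> real \<Rightarrow> real \<Rightarrow> real" where
  "CD_kernel a b n x y = (\<Sum>j\<le>n. opoly a b j x * opoly a b j y)"

definition golden_alpha :: real where
  "golden_alpha = (sqrt 5 - 1) / 2"

definition fib_pot :: "real \<Rightarrow> nat \<Rightarrow> real" where
  "fib_pot \<theta> n = indicator {1 - golden_alpha..<1} (frac (real n * golden_alpha + \<theta>))"

end

theory Submission
  imports Defs "HOL-Number_Theory.Fib"
begin

text \<open>
  Write $v_n = (p_n, p_{n-1})$ and let $q_i$ be the Fibonacci numbers. It suffices to find, for every
  spectral energy and every scale $j$, a position $m$ at distance comparable to $q_j$ to the left of
  $n$ with $|v_m| \ge c |v_n|$: disjoint scales then make $K_n$ exceed any multiple of $p_n^2$,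
  uniformly in the energy. The traces $x_i$ of the transfer matrices over the Fibonacci words obey
  the trace map, so either they are all bounded by a fixed constant at the scales in question, or
  they stay large at all later scales. In the bounded case the potential has, just to the left of $n$,
  a square of period $q_i$ for some $i$ close to $j$, and the Cayley-Hamilton theorem
  $v_n = x_i v_{n-q_i} - v_{n-2q_i}$ gives $m$. In the escaped case (almost) every position is the
  centre of a square with a large trace, so that $|v_n|$ is at most a small multiple of the larger of
  two neighbouring values; hence $J - x$ is bounded below, and $x$ is in the resolvent set, unless $p$
  is square-summable, and a square-summable $p$ obeys a maximum principle that again gives $m$.
\<close>

subsection \<open>Rotation by the golden mean\<close>

text \<open>The obstacle is that the half-line spectrum may contain energies with escaping traces:
  the boundary can create an eigenvalue in a gap, with eigenvector \<open>p\<close>, and the escape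
  may happen at any scale. There the constants in the lower bound for $J - x$ depend on energy and
  scale through \<open>square_err\<close>, so this bound is used only qualitatively, to show that
  \<open>p\<close> is square-summable. The maximum principle that follows needs nothing but traces
  above 128, and so the final constant 130 is uniform. The threshold 128 is dictated by the escaped
  case: moving a centre by one site costs a factor 8 and leaves 1/16, and after squaring and summing
  over at most eight positions 1/4 of the total energy remains, which can be absorbed. Escape itself
  works from 28 on, a bound for the first three traces when |E| <= 5. Squares occur within a bounded
  number of scales because the defect intervals of consecutive scales lie on opposite sides of the
  integers, which nearly determines the distance between their defects.\<close>

lemma golden_alpha_sq: "golden_alpha\<^sup>2 = 1 - golden_alpha"
  by (simp add: golden_alpha_def power2_eq_square field_simps)

lemma golden_alpha_bounds: "61/100 < golden_alpha" "golden_alpha < 62/100"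
proof -
  have "223/100 < sqrt (5::real)" by (rule real_less_rsqrt) (simp add: power2_eq_square)
  then show "61/100 < golden_alpha" by (simp add: golden_alpha_def)
  have "sqrt (5::real) < 224/100" by (rule real_less_lsqrt) (simp_all add: power2_eq_square)
  then show "golden_alpha < 62/100" by (simp add: golden_alpha_def)
qed

lemma golden_alpha_pos: "0 < golden_alpha" and golden_alpha_less_1: "golden_alpha < 1"
  using golden_alpha_bounds by linarith+

section \<open>Convergents of the golden mean\<close>

text \<open>The error of a convergent: \<open>fib (Suc i) * golden_alpha\<close> differs from
  \<open>fib i\<close> by this power of \<open>golden_alpha\<close>, alternately above and
  below.\<close>

definition fib_dist :: "nat \<Rightarrow> real" where
  "fib_dist i = golden_alpha ^ Suc i"

lemma fib_dist_pos: "0 < fib_dist i"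
  by (simp add: fib_dist_def golden_alpha_pos)

lemma fib_dist_rec: "fib_dist i = fib_dist (Suc i) + fib_dist (Suc (Suc i))"
proof -
  have "fib_dist (Suc i) + fib_dist (Suc (Suc i)) = golden_alpha ^ Suc i * (golden_alpha + golden_alpha\<^sup>2)"
    by (simp add: fib_dist_def power2_eq_square algebra_simps)
  then show ?thesis by (simp add: golden_alpha_sq fib_dist_def)
qed

lemma fib_dist_Suc_less: "fib_dist (Suc i) < fib_dist i"
  using fib_dist_rec[of i] fib_dist_pos[of "Suc (Suc i)"] by linarith

lemma fib_dist_antimono: "i \<le> j \<Longrightarrow> fib_dist j \<le> fib_dist i"
  by (induction rule: dec_induct) (auto intro: order_trans less_imp_le fib_dist_Suc_less)

lemma fib_dist_values: "fib_dist 0 = golden_alpha" "fib_dist (Suc 0) = 1 - golden_alpha"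
    "fib_dist 2 = 2 * golden_alpha - 1" "fib_dist 3 = 2 - 3 * golden_alpha" "fib_dist 4 = 5 * golden_alpha - 3"
proof -
  show 0: "fib_dist 0 = golden_alpha" by (simp add: fib_dist_def)
  show 1: "fib_dist (Suc 0) = 1 - golden_alpha"
    using golden_alpha_sq by (simp add: fib_dist_def power2_eq_square)
  show 2: "fib_dist 2 = 2 * golden_alpha - 1"
    using fib_dist_rec[of 0] 0 1 by (simp add: numeral_eq_Suc)
  show 3: "fib_dist 3 = 2 - 3 * golden_alpha"
    using fib_dist_rec[of 1] 1 2 by (simp add: numeral_eq_Suc)
  show "fib_dist 4 = 5 * golden_alpha - 3"
    using fib_dist_rec[of 2] 3 2 by (simp add: numeral_eq_Suc)
qed

definition fib_disp :: "nat \<Rightarrow> real" where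
  "fib_disp i = (if even i then fib_dist i else - fib_dist i)"

lemma fib_golden_alpha: "real (fib (Suc i)) * golden_alpha = real (fib i) + fib_disp i"
proof (induction i rule: fib.induct)
  case 1
  then show ?case by (simp add: fib_disp_def fib_dist_values)
next
  case 2
  then show ?case by (simp add: fib_disp_def fib_dist_values)
next
  case (3 i)
  have "fib_disp (Suc (Suc i)) = fib_disp (Suc i) + fib_disp i"
    using fib_dist_rec[of i] by (simp add: fib_disp_def)
  with 3 show ?case by (simp add: algebra_simps)
qed

section \<open>The potential as a difference of floors, and its defects\<close>

definition phase :: "real \<Rightarrow> int \<Rightarrow> real" where
  "phase \<theta> j = of_int j * golden_alpha + \<theta>"

text \<open>The floor form extends the potential to negative sites, so that one can always walk left to a defect.\<close>
definition fib_letter :: "real \<Rightarrow> int \<Rightarrow> real" where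
  "fib_letter \<theta> j = of_int (\<lfloor>phase \<theta> (j + 1)\<rfloor> - \<lfloor>phase \<theta> j\<rfloor>)"

lemma phase_add: "phase \<theta> (j + k) = phase \<theta> j + of_int k * golden_alpha"
  by (simp add: phase_def algebra_simps)

lemma fib_pot_eq_fib_letter: "fib_pot \<theta> n = fib_letter \<theta> (int n)"
proof -
  define x where "x = real n * golden_alpha + \<theta>"
  have "phase \<theta> (int n) = x" "phase \<theta> (int n + 1) = x + golden_alpha"
    by (simp_all add: phase_def x_def algebra_simps)
  moreover have "\<lfloor>x + golden_alpha\<rfloor> = \<lfloor>x\<rfloor> + (if 1 - golden_alpha \<le> frac x then 1 else 0)"
    using golden_alpha_pos golden_alpha_less_1 unfolding frac_def
    by (auto simp: floor_eq_iff) linarith+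
  moreover have "frac x < 1" by (rule frac_lt_1)
  ultimately show ?thesis
    by (simp add: fib_pot_def fib_letter_def x_def indicator_def)
qed

lemma fib_letter_01: "fib_letter \<theta> j = 0 \<or> fib_letter \<theta> j = 1"
proof -
  have "\<lfloor>phase \<theta> j + golden_alpha\<rfloor> = \<lfloor>phase \<theta> j\<rfloor> \<or> \<lfloor>phase \<theta> j + golden_alpha\<rfloor> = \<lfloor>phase \<theta> j\<rfloor> + 1"
    using golden_alpha_pos golden_alpha_less_1 by linarith
  then show ?thesis by (auto simp: fib_letter_def phase_add)
qed

text \<open>The two discontinuities of the potential differ by one rotation step, so the sites where it fails to
  have period \<open>fib (Suc i)\<close> come in pairs \<open>j - 1, j\<close> with a defect at \<open>j\<close>.\<close>
definition fib_defect :: "real \<Rightarrow> nat \<Rightarrow> int \<Rightarrow> bool" where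
  "fib_defect \<theta> i j \<longleftrightarrow> \<lfloor>phase \<theta> j + fib_disp i\<rfloor> \<noteq> \<lfloor>phase \<theta> j\<rfloor>"

lemma floor_phase_add_fib: 
  "\<lfloor>phase \<theta> (j + int (fib (Suc i)))\<rfloor> = \<lfloor>phase \<theta> j + fib_disp i\<rfloor> + int (fib i)"
proof -
  have "phase \<theta> (j + int (fib (Suc i))) = phase \<theta> j + fib_disp i + of_int (int (fib i))"
    using fib_golden_alpha[of i] by (simp add: phase_add del: fib.simps)
  then show ?thesis by (simp only: floor_add_int)
qed

lemma fib_letter_add_fib:
  assumes "\<not> fib_defect \<theta> i j" "\<not> fib_defect \<theta> i (j + 1)"
  shows "fib_letter \<theta> (j + int (fib (Suc i))) = fib_letter \<theta> j"
proof -
  have "\<lfloor>phase \<theta> (j + int (fib (Suc i)) + 1)\<rfloor> = \<lfloor>phase \<theta> (j + 1)\<rfloor> + int (fib i)"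
    using floor_phase_add_fib[of \<theta> "j + 1" i] assms by (simp add: fib_defect_def add_ac del: fib.simps)
  moreover have "\<lfloor>phase \<theta> (j + int (fib (Suc i)))\<rfloor> = \<lfloor>phase \<theta> j\<rfloor> + int (fib i)"
    using floor_phase_add_fib[of \<theta> "j" i] assms by (simp add: fib_defect_def add_ac del: fib.simps)
  ultimately show ?thesis by (simp add: fib_letter_def del: fib.simps)
qed

text \<open>The parity of the scale decides on which side of the integers a defect phase lies: just
  below them for even scales, at or just above them for odd ones. Consecutive scales thus never
  share a defect.\<close>

lemma fib_defect_even_iff:
  assumes "even i"
  shows "fib_defect \<theta> i j \<longleftrightarrow> (\<exists>z::int. - fib_dist i \<le> phase \<theta> j - z \<and> phase \<theta> j - z < 0)" (is "_ \<longleftrightarrow> ?R")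
proof
  assume "fib_defect \<theta> i j"
  then have "\<lfloor>phase \<theta> j\<rfloor> < \<lfloor>phase \<theta> j + fib_dist i\<rfloor>"
    using assms floor_mono[of "phase \<theta> j" "phase \<theta> j + fib_dist i"] fib_dist_pos[of i]
    by (simp add: fib_defect_def fib_disp_def)
  then show ?R
    by (intro exI[of _ "\<lfloor>phase \<theta> j + fib_dist i\<rfloor>"]) linarith
next
  assume ?R
  then obtain z :: int where "- fib_dist i \<le> phase \<theta> j - z" "phase \<theta> j - z < 0" by blast
  then have "z \<le> \<lfloor>phase \<theta> j + fib_dist i\<rfloor>" "\<lfloor>phase \<theta> j\<rfloor> < z"
    by (simp_all add: le_floor_iff floor_less_iff)
  then show "fib_defect \<theta> i j"
    using assms by (simp add: fib_defect_def fib_disp_def)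
qed

lemma fib_defect_odd_iff:
  assumes "odd i"
  shows "fib_defect \<theta> i j \<longleftrightarrow> (\<exists>z::int. 0 \<le> phase \<theta> j - z \<and> phase \<theta> j - z < fib_dist i)" (is "_ \<longleftrightarrow> ?R")
proof
  assume "fib_defect \<theta> i j"
  then have "\<lfloor>phase \<theta> j - fib_dist i\<rfloor> < \<lfloor>phase \<theta> j\<rfloor>"
    using assms floor_mono[of "phase \<theta> j - fib_dist i" "phase \<theta> j"] fib_dist_pos[of i]
    by (simp add: fib_defect_def fib_disp_def)
  then show ?R
    by (intro exI[of _ "\<lfloor>phase \<theta> j\<rfloor>"]) linarith
next
  assume ?R
  then obtain z :: int where "0 \<le> phase \<theta> j - z" "phase \<theta> j - z < fib_dist i" by blast
  then have "z \<le> \<lfloor>phase \<theta> j\<rfloor>" "\<lfloor>phase \<theta> j - fib_dist i\<rfloor> < z"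
    by (simp_all add: le_floor_iff floor_less_iff)
  then show "fib_defect \<theta> i j"
    using assms by (simp add: fib_defect_def fib_disp_def)
qed

lemma fib_defect_near:
  assumes "fib_defect \<theta> i j"
  obtains z :: int where "\<bar>phase \<theta> j - z\<bar> \<le> fib_dist i"
proof -
  have "\<exists>z::int. \<bar>phase \<theta> j - z\<bar> \<le> fib_dist i"
  proof (cases "even i")
    case True
    then obtain z :: int where "- fib_dist i \<le> phase \<theta> j - z" "phase \<theta> j - z < 0"
      using assms by (auto simp: fib_defect_even_iff)
    then show ?thesis by (intro exI[of _ z]) linarith
  next
    case False
    then obtain z :: int where "0 \<le> phase \<theta> j - z" "phase \<theta> j - z < fib_dist i"
      using assms by (auto simp: fib_defect_odd_iff)
    then show ?thesis by (intro exI[of _ z]) linarith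
  qed
  then show thesis using that by blast
qed

section \<open>Distances between defects of consecutive scales\<close>

lemma fib_det:
  "int (fib (Suc i)) * int (fib (Suc i)) - int (fib i) * int (fib (Suc (Suc i))) = (if even i then 1 else - 1)"
  by (induction i) (auto simp: algebra_simps)

text \<open>By Cassini's identity the two Fibonacci vectors have determinant 1 or -1 and so generate
  the integer lattice; the coefficients are Cramer's rule, with \<open>e\<close> its own
  inverse.\<close>

lemma fib_basis:
  fixes r s :: int
  obtains a b :: int where "r = a * int (fib (Suc i)) - b * int (fib (Suc (Suc i)))"
    "s = a * int (fib i) - b * int (fib (Suc i))"
proof -
  define e :: int where "e = (if even i then 1 else - 1)"
  define Q P R where "Q = int (fib (Suc i))" and "P = int (fib i)" and "R = int (fib (Suc (Suc i)))"
  have e: "e * e = 1" by (simp add: e_def)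
  have d: "Q * Q - P * R = e" using fib_det[of i] by (simp add: Q_def P_def R_def e_def del: fib.simps)
  show thesis
  proof
    have "e * (r * Q - s * R) * Q - e * (r * P - s * Q) * R = e * (Q * Q - P * R) * r" by algebra
    then show "r = e * (r * Q - s * R) * int (fib (Suc i)) - e * (r * P - s * Q) * int (fib (Suc (Suc i)))"
      using e d by (simp add: Q_def P_def R_def del: fib.simps)
    have "e * (r * Q - s * R) * P - e * (r * P - s * Q) * Q = e * (Q * Q - P * R) * s" by algebra
    then show "s = e * (r * Q - s * R) * int (fib i) - e * (r * P - s * Q) * int (fib (Suc i))"
      using e d by (simp add: Q_def P_def R_def del: fib.simps)
  qed
qed

text \<open>In the lattice basis of two consecutive convergents the displacement between the two
  phases becomes \<open>a * fib_dist i + b * fib_dist (Suc i)\<close>. It lies strictly between 0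
  and the sum of both distances, so \<open>a\<close> and \<open>b\<close> are neither both positive
  nor both nonpositive. With opposite signs the two terms of \<open>r\<close> reinforce each other,
  which leaves two short distances and otherwise only long ones.\<close>

lemma fib_defect_fib_defect_Suc_diff:
  assumes "fib_defect \<theta> i j" "fib_defect \<theta> (Suc i) j'"
  shows "j' - j = int (fib (Suc i)) \<or> j' - j = - int (fib (Suc (Suc i))) \<or>
         j' - j \<ge> 2 * int (fib (Suc i)) \<or> j' - j \<le> - int (fib (Suc (Suc (Suc i))))"
proof -
  define r where "r = j' - j"
  define e :: real where "e = (if even i then 1 else - 1)"
  \<comment> \<open>The sign \<open>e\<close> treats both parities at once: the two phases lie on
    opposite sides of integers that differ by \<open>s\<close>.\<close>
  obtain s :: int where s: "0 < e * (r * golden_alpha - s)" "e * (r * golden_alpha - s) < fib_dist i + fib_dist (Suc i)"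
  proof (cases "even i")
    case True
    with assms obtain z z' :: int where
      "- fib_dist i \<le> phase \<theta> j - z" "phase \<theta> j - z < 0"
      "0 \<le> phase \<theta> j' - z'" "phase \<theta> j' - z' < fib_dist (Suc i)"
      by (auto simp: fib_defect_even_iff fib_defect_odd_iff)
    then show ?thesis using True
      by (intro that[of "z' - z"]) (auto simp: e_def r_def phase_def algebra_simps)
  next
    case False
    with assms obtain z z' :: int where
      "0 \<le> phase \<theta> j - z" "phase \<theta> j - z < fib_dist i"
      "- fib_dist (Suc i) \<le> phase \<theta> j' - z'" "phase \<theta> j' - z' < 0"
      by (auto simp: fib_defect_even_iff fib_defect_odd_iff)
    then show ?thesis using False
      by (intro that[of "z' - z"]) (auto simp: e_def r_def phase_def algebra_simps)
  qed
  obtain a b :: int where ab: "r = a * int (fib (Suc i)) - b * int (fib (Suc (Suc i)))"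
    "s = a * int (fib i) - b * int (fib (Suc i))" by (rule fib_basis)
  have "e * (r * golden_alpha - s) = e * (a * (fib (Suc i) * golden_alpha - fib i)
      - b * (fib (Suc (Suc i)) * golden_alpha - fib (Suc i)))"
    unfolding ab by (simp add: algebra_simps del: fib.simps)
  also have "\<dots> = a * fib_dist i + b * fib_dist (Suc i)"
    by (simp only: fib_golden_alpha) (auto simp: e_def fib_disp_def algebra_simps)
  finally have *: "0 < a * fib_dist i + b * fib_dist (Suc i)" "a * fib_dist i + b * fib_dist (Suc i) < fib_dist i + fib_dist (Suc i)"
    using s by simp_all
  have "\<not> (a \<ge> 1 \<and> b \<ge> 1)"
  proof
    assume "a \<ge> 1 \<and> b \<ge> 1"
    then have "1 * fib_dist i \<le> a * fib_dist i" "1 * fib_dist (Suc i) \<le> b * fib_dist (Suc i)"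
      by (intro mult_right_mono less_imp_le[OF fib_dist_pos]; simp)+
    with *(2) show False by simp
  qed
  moreover have "\<not> (a \<le> 0 \<and> b \<le> 0)"
  proof
    assume "a \<le> 0 \<and> b \<le> 0"
    then have "a * fib_dist i \<le> 0" "b * fib_dist (Suc i) \<le> 0"
      by (auto intro!: mult_nonpos_nonneg less_imp_le[OF fib_dist_pos])
    with *(1) show False by simp
  qed
  moreover define Q R where "Q = int (fib (Suc i))" and "R = int (fib (Suc (Suc i)))"
  have QR: "0 < Q" "Q \<le> R" by (auto simp: Q_def R_def fib_neq_0_nat)
  have R': "int (fib (Suc (Suc (Suc i)))) = R + Q" by (simp add: Q_def R_def)
  have r: "r = a * Q - b * R" using ab by (simp add: Q_def R_def del: fib.simps)
  ultimately consider "a = 1" "b = 0" | "a \<ge> 2" "b \<le> 0" | "a \<ge> 1" "b \<le> -1" | "a = 0" "b = 1" | "a \<le> 0" "b \<ge> 2" | "a \<le> -1" "b \<ge> 1"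
    by linarith
  then have "r = Q \<or> r = - R \<or> r \<ge> 2 * Q \<or> r \<le> - (R + Q)"
  proof cases
    case 2
    then have "2 * Q \<le> a * Q" "b * R \<le> 0 * R" using QR by (intro mult_right_mono; simp)+
    then show ?thesis using r by simp
  next
    case 3
    then have "1 * Q \<le> a * Q" "b * R \<le> (-1) * R" using QR by (intro mult_right_mono; simp)+
    then show ?thesis using r QR by linarith
  next
    case 5
    then have "a * Q \<le> 0 * Q" "2 * R \<le> b * R" using QR by (intro mult_right_mono; simp)+
    then show ?thesis using r QR by linarith
  next
    case 6
    then have "a * Q \<le> (-1) * Q" "1 * R \<le> b * R" using QR by (intro mult_right_mono; simp)+
    then show ?thesis using r QR by linarith
  qed (use r in auto)
  then show ?thesis unfolding R' by (simp add: r_def Q_def R_def del: fib.simps)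
qed

section \<open>Squares to the right, to the left and around a site\<close>

text \<open>The right end is included because periodicity of the letter at the last site before it
  also requires that the next site be no defect. The word of twice this length starting at
  \<open>n\<close> is then a square.\<close>

definition defect_free :: "real \<Rightarrow> nat \<Rightarrow> int \<Rightarrow> bool" where
  "defect_free \<theta> i n \<longleftrightarrow> (\<forall>m. n \<le> m \<and> m \<le> n + int (fib (Suc i)) \<longrightarrow> \<not> fib_defect \<theta> i m)"

lemma fib_less_Suc: "2 \<le> i \<Longrightarrow> fib i < fib (Suc i)"
  using fib_neq_0_nat[of "i - 1"] by (cases i rule: fib.cases) auto

lemma fib_Suc_Suc_less_double: "2 \<le> i \<Longrightarrow> fib (Suc (Suc i)) < 2 * fib (Suc i)"
  using fib_less_Suc[of i] by simp

lemma fib_Suc_Suc_int: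
  "int (fib (Suc (Suc i))) = int (fib (Suc i)) + int (fib i)"
  by simp

text \<open>If all four scales had a defect in their windows, each defect would have to sit exactly
  \<open>fib (Suc i)\<close> to the right of that of scale \<open>i\<close>, since all other
  admissible distances leave the window. Three such steps add up to more than the last window
  holds.\<close>

lemma ex_defect_free_right:
  assumes "2 \<le> j"
  shows "\<exists>i. j \<le> i \<and> i \<le> j + 3 \<and> defect_free \<theta> i n"
proof (rule ccontr)
  assume *: "\<not> ?thesis"
  have ex: "\<exists>a. fib_defect \<theta> i (n + a) \<and> 0 \<le> a \<and> a \<le> int (fib (Suc i))" if "j \<le> i" "i \<le> j + 3" for i
  proof -
    from * that obtain m where "n \<le> m" "m \<le> n + int (fib (Suc i))" "fib_defect \<theta> i m"
      unfolding defect_free_def by blast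
    then show ?thesis by (intro exI[of _ "m - n"]) (auto simp del: fib.simps)
  qed
  have step: "b = a + int (fib (Suc i))"
    if "2 \<le> i" "fib_defect \<theta> i (n + a)" "fib_defect \<theta> (Suc i) (n + b)"
      "0 \<le> a" "a \<le> int (fib (Suc i))" "0 \<le> b" "b \<le> int (fib (Suc (Suc i)))" for i a b
    using fib_defect_fib_defect_Suc_diff[OF that(2,3)] fib_Suc_Suc_less_double[OF that(1)]
      fib_less_Suc[of "Suc i"] that
    by (auto simp del: fib.simps simp: fib_Suc_Suc_int[of "Suc i"])
  obtain a0 where a0: "fib_defect \<theta> j (n + a0)" "0 \<le> a0" "a0 \<le> int (fib (Suc j))" using ex[of j] by auto
  obtain a1 where a1: "fib_defect \<theta> (Suc j) (n + a1)" "0 \<le> a1" "a1 \<le> int (fib (Suc (Suc j)))" using ex[of "Suc j"] by auto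
  obtain a2 where a2: "fib_defect \<theta> (Suc (Suc j)) (n + a2)" "0 \<le> a2" "a2 \<le> int (fib (Suc (Suc (Suc j))))"
    using ex[of "Suc (Suc j)"] by auto
  obtain a3 where a3: "fib_defect \<theta> (Suc (Suc (Suc j))) (n + a3)" "0 \<le> a3" "a3 \<le> int (fib (Suc (Suc (Suc (Suc j)))))"
    using ex[of "Suc (Suc (Suc j))"] by auto
  have "a1 = a0 + int (fib (Suc j))" using assms a0 a1 by (intro step) auto
  moreover have "a2 = a1 + int (fib (Suc (Suc j)))" using assms a1 a2 by (intro step) auto
  moreover have "a3 = a2 + int (fib (Suc (Suc (Suc j))))" using assms a2 a3 by (intro step) auto
  ultimately show False
    using a0(2) a3(3) fib_neq_0_nat[of "Suc j"]
    by (simp only: fib_Suc_Suc_int[of "Suc (Suc j)"] fib_Suc_Suc_int[of "Suc j"]) auto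
qed

text \<open>The mirror image, for squares that end just before \<open>n\<close>: here successive
  defects are forced to move left by \<open>fib (Suc (Suc i))\<close>, and three moves overshoot the
  last window. This is the form needed for comparing \<open>p\<close> with its earlier
  values.\<close>

lemma ex_defect_free_left:
  assumes "2 \<le> j"
  shows "\<exists>i. j \<le> i \<and> i \<le> j + 3 \<and> defect_free \<theta> i (n - 2 * int (fib (Suc i)))"
proof (rule ccontr)
  assume *: "\<not> ?thesis"
  have ex: "\<exists>a. fib_defect \<theta> i (n - a) \<and> int (fib (Suc i)) \<le> a \<and> a \<le> 2 * int (fib (Suc i))"
    if "j \<le> i" "i \<le> j + 3" for i
  proof -
    from * that obtain m where "n - 2 * int (fib (Suc i)) \<le> m"
      "m \<le> n - 2 * int (fib (Suc i)) + int (fib (Suc i))" "fib_defect \<theta> i m"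
      unfolding defect_free_def by blast
    then show ?thesis by (intro exI[of _ "n - m"]) (auto simp del: fib.simps)
  qed
  have step: "b = a + int (fib (Suc (Suc i)))"
    if "2 \<le> i" "fib_defect \<theta> i (n - a)" "fib_defect \<theta> (Suc i) (n - b)"
      "int (fib (Suc i)) \<le> a" "a \<le> 2 * int (fib (Suc i))"
      "int (fib (Suc (Suc i))) \<le> b" "b \<le> 2 * int (fib (Suc (Suc i)))" for i a b
    using fib_defect_fib_defect_Suc_diff[OF that(2,3)] fib_Suc_Suc_less_double[OF that(1)]
      fib_less_Suc[of "Suc i"] that
    by (auto simp del: fib.simps simp: fib_Suc_Suc_int[of "Suc i"])
  obtain a0 where a0: "fib_defect \<theta> j (n - a0)" "int (fib (Suc j)) \<le> a0" "a0 \<le> 2 * int (fib (Suc j))" using ex[of j] by auto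
  obtain a1 where a1: "fib_defect \<theta> (Suc j) (n - a1)" "int (fib (Suc (Suc j))) \<le> a1" "a1 \<le> 2 * int (fib (Suc (Suc j)))"
    using ex[of "Suc j"] by auto
  obtain a2 where a2: "fib_defect \<theta> (Suc (Suc j)) (n - a2)" "int (fib (Suc (Suc (Suc j)))) \<le> a2"
    "a2 \<le> 2 * int (fib (Suc (Suc (Suc j))))"
    using ex[of "Suc (Suc j)"] by auto
  obtain a3 where a3: "fib_defect \<theta> (Suc (Suc (Suc j))) (n - a3)" "int (fib (Suc (Suc (Suc (Suc j))))) \<le> a3"
    "a3 \<le> 2 * int (fib (Suc (Suc (Suc (Suc j)))))"
    using ex[of "Suc (Suc (Suc j))"] by auto
  have "a1 = a0 + int (fib (Suc (Suc j)))" using assms a0 a1 by (intro step) auto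
  moreover have "a2 = a1 + int (fib (Suc (Suc (Suc j))))" using assms a1 a2 by (intro step) auto
  moreover have "a3 = a2 + int (fib (Suc (Suc (Suc (Suc j)))))" using assms a2 a3 by (intro step) auto
  ultimately show False
    using a0(2) a3(3) fib_neq_0_nat[of "Suc j"]
    by (simp only: fib_Suc_Suc_int[of "Suc (Suc j)"] fib_Suc_Suc_int[of "Suc j"]) auto
qed

text \<open>At the singular phase $0$ every scale has a defect, hence the freedom to move by one site.\<close>
lemma ex_defect_free_center:
  assumes "3 \<le> j"
  shows "\<exists>n'\<in>{n, n + 1}. \<exists>i\<in>{j, Suc j}. defect_free \<theta> i (n' - int (fib (Suc i)))"
proof (rule ccontr)
  assume *: "\<not> ?thesis"
  have near: "\<exists>z::int. \<bar>phase \<theta> n' - z\<bar> \<le> fib_dist 3" if "n' \<in> {n, n + 1}" for n'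
  proof -
    have ex: "\<exists>a. fib_defect \<theta> i (n' - a) \<and> 0 \<le> a \<and> a \<le> int (fib (Suc i))" if "i \<in> {j, Suc j}" for i
    proof -
      from * that \<open>n' \<in> {n, n + 1}\<close> obtain m where "n' - int (fib (Suc i)) \<le> m"
        "m \<le> n' - int (fib (Suc i)) + int (fib (Suc i))" "fib_defect \<theta> i m"
        unfolding defect_free_def by blast
      then show ?thesis by (intro exI[of _ "n' - m"]) (auto simp del: fib.simps)
    qed
    obtain a where a: "fib_defect \<theta> j (n' - a)" "0 \<le> a" "a \<le> int (fib (Suc j))" using ex[of j] by auto
    obtain b where b: "fib_defect \<theta> (Suc j) (n' - b)" "0 \<le> b" "b \<le> int (fib (Suc (Suc j)))" using ex[of "Suc j"] by auto
    \<comment> \<open>Both defects lie in windows that end at \<open>n'\<close>, and the only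
      distances short enough put one of them at \<open>n'\<close> itself.\<close>
    have "a = 0 \<or> b = 0"
      using fib_defect_fib_defect_Suc_diff[OF a(1) b(1)] a b fib_neq_0_nat[of "Suc j"] fib_neq_0_nat[of "Suc (Suc j)"]
      by (auto simp del: fib.simps simp: fib_Suc_Suc_int[of "Suc j"])
    then have "fib_defect \<theta> j n' \<or> fib_defect \<theta> (Suc j) n'" using a b by auto
    then obtain z :: int where "\<bar>phase \<theta> n' - z\<bar> \<le> fib_dist j \<or> \<bar>phase \<theta> n' - z\<bar> \<le> fib_dist (Suc j)"
      by (meson fib_defect_near)
    moreover have "fib_dist j \<le> fib_dist 3" "fib_dist (Suc j) \<le> fib_dist 3"
      using assms by (auto intro: fib_dist_antimono)
    ultimately show ?thesis by (intro exI[of _ z]) linarith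
  qed
  obtain z z' :: int where z: "\<bar>phase \<theta> n - z\<bar> \<le> fib_dist 3" "\<bar>phase \<theta> (n + 1) - z'\<bar> \<le> fib_dist 3"
    using near[of n] near[of "n + 1"] by auto
  have "phase \<theta> (n + 1) = phase \<theta> n + golden_alpha" by (simp add: phase_add)
  \<comment> \<open>Two adjacent sites cannot both have a phase this close to an integer, because
    \<open>golden_alpha\<close> is farther than \<open>2 * fib_dist 3\<close> from every
    integer.\<close>
  then have "\<bar>golden_alpha - of_int (z' - z)\<bar> \<le> 2 * fib_dist 3" using z by simp
  then have "\<bar>golden_alpha - of_int (z' - z)\<bar> < 38/100"
    using golden_alpha_bounds by (simp add: fib_dist_values)
  then have "0 < real_of_int (z' - z)" "real_of_int (z' - z) < 1"
    using golden_alpha_bounds by linarith+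
  then have "0 < z' - z" "z' - z < 1" by (simp_all only: of_int_0_less_iff of_int_less_1_iff)
  then show False by simp
qed

text \<open>Translation by \<open>fib (Suc i)\<close> moves the phase by exactly the length of the defect interval,
  so the interval cannot be skipped.\<close>
lemma ex_fib_defect_le: "\<exists>j\<le>n. fib_defect \<theta> i j"
proof (cases "even i")
  case True
  have d: "fib_dist i > 0" by (rule fib_dist_pos)
  \<comment> \<open>The number of translations, each lowering the phase by \<open>fib_dist i\<close>
    modulo 1, after which it first falls below an integer.\<close>
  define t where "t = nat \<lfloor>frac (phase \<theta> n) / fib_dist i\<rfloor> + 1"
  have t: "real t = \<lfloor>frac (phase \<theta> n) / fib_dist i\<rfloor> + 1"
    using d by (simp add: t_def)
  have t1: "frac (phase \<theta> n) / fib_dist i < real t" "real t \<le> frac (phase \<theta> n) / fib_dist i + 1"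
    unfolding t by linarith+
  have t': "frac (phase \<theta> n) < real t * fib_dist i" "real t * fib_dist i \<le> frac (phase \<theta> n) + fib_dist i"
    using t1 d by (simp_all add: field_simps)
  have "phase \<theta> (n - int t * int (fib (Suc i))) = phase \<theta> n - real t * (real (fib (Suc i)) * golden_alpha)"
    by (simp add: phase_def algebra_simps del: fib.simps)
  also have "\<dots> = phase \<theta> n - real t * fib_dist i - real t * real (fib i)"
    unfolding fib_golden_alpha using True by (simp add: fib_disp_def algebra_simps)
  finally have "fib_defect \<theta> i (n - int t * int (fib (Suc i)))"
    unfolding fib_defect_even_iff[OF True]
    using t' by (intro exI[of _ "\<lfloor>phase \<theta> n\<rfloor> - int t * int (fib i)"]) (simp add: frac_def)
  moreover have "n - int t * int (fib (Suc i)) \<le> n" by simp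
  ultimately show ?thesis by blast
next
  case False
  have d: "fib_dist i > 0" by (rule fib_dist_pos)
  define t where "t = nat \<lceil>(1 - frac (phase \<theta> n)) / fib_dist i\<rceil>"
  have t: "real t = \<lceil>(1 - frac (phase \<theta> n)) / fib_dist i\<rceil>"
    using d frac_lt_1[of "phase \<theta> n"] by (simp add: t_def)
  have t1: "(1 - frac (phase \<theta> n)) / fib_dist i \<le> real t" "real t < (1 - frac (phase \<theta> n)) / fib_dist i + 1"
    unfolding t by linarith+
  have t': "1 - frac (phase \<theta> n) \<le> real t * fib_dist i" "real t * fib_dist i < 1 - frac (phase \<theta> n) + fib_dist i"
    using t1 d by (simp_all add: field_simps)
  have "phase \<theta> (n - int t * int (fib (Suc i))) = phase \<theta> n - real t * (real (fib (Suc i)) * golden_alpha)"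
    by (simp add: phase_def algebra_simps del: fib.simps)
  also have "\<dots> = phase \<theta> n + real t * fib_dist i - real t * real (fib i)"
    unfolding fib_golden_alpha using False by (simp add: fib_disp_def algebra_simps)
  finally have "fib_defect \<theta> i (n - int t * int (fib (Suc i)))"
    unfolding fib_defect_odd_iff[OF False]
    using t' by (intro exI[of _ "\<lfloor>phase \<theta> n\<rfloor> + 1 - int t * int (fib i)"]) (simp add: frac_def)
  moreover have "n - int t * int (fib (Suc i)) \<le> n" by simp
  ultimately show ?thesis by blast
qed

lemma fib_Suc_ge: "j \<le> fib (Suc j)"
proof (induction j rule: fib.induct)
  case (3 j)
  then show ?case using fib_neq_0_nat[of "Suc j"] by simp
qed auto

lemma four_fib_less: "0 < k \<Longrightarrow> 4 * fib k < fib (k + 4)"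
  using fib_mono[of k "Suc k"] fib_neq_0_nat[of k] by (simp add: numeral_eq_Suc)

subsection \<open>Transfer matrices and the trace map\<close>

definition transfer_matrix :: "real \<Rightarrow> real \<Rightarrow> real^2^2" where
  "transfer_matrix E b = vector [vector [E - b, -1], vector [1, 0]]"

fun transfer_prod :: "(int \<Rightarrow> real) \<Rightarrow> real \<Rightarrow> int \<Rightarrow> nat \<Rightarrow> real^2^2" where
  "transfer_prod w E n 0 = mat 1"
| "transfer_prod w E n (Suc l) = transfer_matrix E (w (n + int l)) ** transfer_prod w E n l"

lemma det_transfer_matrix: "det (transfer_matrix E b) = 1"
  by (simp add: det_2 transfer_matrix_def)

lemma det_transfer_prod: "det (transfer_prod w E n l) = 1"
  by (induction l) (simp_all add: det_mul det_transfer_matrix)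

lemma transfer_prod_add: "transfer_prod w E n (k + l) = transfer_prod w E (n + int k) l ** transfer_prod w E n k"
  by (induction l) (simp_all add: matrix_mul_assoc add_ac)

lemma transfer_prod_cong:
  "(\<And>k. k < l \<Longrightarrow> w (n + int k) = w (m + int k)) \<Longrightarrow> transfer_prod w E n l = transfer_prod w E m l"
  by (induction l) simp_all

lemma trace_transfer_prod_shift:
  assumes "w (n + int l) = w n"
  shows "trace (transfer_prod w E (n + 1) l) = trace (transfer_prod w E n l)"
proof -
  have "transfer_prod w E (n + 1) l ** transfer_matrix E (w n) = transfer_prod w E n (1 + l)"
    by (simp only: transfer_prod_add) simp
  also have "\<dots> = transfer_matrix E (w n) ** transfer_prod w E n l"
    using assms by simp
  finally have *: "transfer_prod w E (n + 1) l ** transfer_matrix E (w n) = transfer_matrix E (w n) ** transfer_prod w E n l" .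
  obtain X where X: "transfer_matrix E (w n) ** X = mat 1"
    using det_transfer_matrix[of E "w n"] invertible_det_nz[of "transfer_matrix E (w n)"] by (auto simp: invertible_def)
  have X': "X ** transfer_matrix E (w n) = mat 1"
    using X by (simp add: matrix_left_right_inverse)
  have "trace (transfer_prod w E (n + 1) l) = trace (transfer_prod w E (n + 1) l ** transfer_matrix E (w n) ** X)"
    by (simp add: X flip: matrix_mul_assoc)
  also have "\<dots> = trace (X ** (transfer_matrix E (w n) ** transfer_prod w E n l))"
    unfolding * by (rule trace_mul_sym)
  also have "\<dots> = trace (transfer_prod w E n l)"
    by (simp add: matrix_mul_assoc X')
  finally show ?thesis .
qed

lemma trace_2: "trace (A :: real^2^2) = A$1$1 + A$2$2"
  by (simp add: trace_def sum_2)

lemma cayley_hamilton_2: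
  fixes A :: "real^2^2"
  assumes "det A = 1"
  shows "A *v (A *v x) = trace A *\<^sub>R (A *v x) - x"
proof -
  have d: "A$1$1 * A$2$2 - A$1$2 * A$2$1 = 1" using assms by (simp add: det_2)
  show ?thesis
    unfolding vec_eq_iff forall_2 matrix_vector_mult_def trace_2
    using d by (simp add: sum_2) algebra
qed

text \<open>By cyclicity the trace of \<open>A ** C ** A\<close> is that of
  \<open>C ** A ** A\<close>, and Cayley-Hamilton reduces the square of \<open>A\<close>.\<close>

lemma trace_mul_inverse_2:
  fixes A B C :: "real^2^2"
  assumes "det A = 1" "B = C ** A"
  shows "trace (A ** B) = trace A * trace B - trace C"
proof -
  have d: "A$1$1 * A$2$2 - A$1$2 * A$2$1 = 1" using assms by (simp add: det_2)
  show ?thesis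
    unfolding assms(2) trace_2 matrix_matrix_mult_def
    using d by (simp add: sum_2) algebra
qed

section \<open>The trace map and the escape of traces\<close>

text \<open>The rightmost factor acts first, so this product belongs to the word of level
  \<open>Suc k\<close> followed by the word of level \<open>k\<close>, starting from the one-letter
  words 0 and 1. The word of level \<open>k\<close> has length \<open>fib (Suc k)\<close>.\<close>

fun fib_matrix :: "real \<Rightarrow> nat \<Rightarrow> real^2^2" where
  "fib_matrix E 0 = transfer_matrix E 0"
| "fib_matrix E (Suc 0) = transfer_matrix E 1"
| "fib_matrix E (Suc (Suc k)) = fib_matrix E k ** fib_matrix E (Suc k)"

definition fib_trace :: "real \<Rightarrow> nat \<Rightarrow> real" where
  "fib_trace E k = trace (fib_matrix E k)"

lemma det_fib_matrix: "det (fib_matrix E k) = 1"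
  by (induction k rule: fib.induct) (simp_all add: det_transfer_matrix det_mul)

lemma fib_trace_rec: "fib_trace E (Suc (Suc (Suc k))) = fib_trace E (Suc (Suc k)) * fib_trace E (Suc k) - fib_trace E k"
  using trace_mul_inverse_2[OF det_fib_matrix, of "fib_matrix E (Suc (Suc k))" "fib_matrix E k" E "Suc k"]
  by (simp add: fib_trace_def)

lemma fib_trace_init: "fib_trace E 0 = E" "fib_trace E (Suc 0) = E - 1" "fib_trace E 2 = E * (E - 1) - 2"
proof -
  show "fib_trace E 0 = E" "fib_trace E (Suc 0) = E - 1" by (simp_all add: fib_trace_def transfer_matrix_def trace_2)
  have "fib_matrix E 2 = transfer_matrix E 0 ** transfer_matrix E 1" by (simp add: numeral_2_eq_2)
  then show "fib_trace E 2 = E * (E - 1) - 2"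
    by (simp add: fib_trace_def trace_2 transfer_matrix_def matrix_matrix_mult_def sum_2)
qed

text \<open>The Fricke-Vogt invariant of the trace map; its value is 4 plus the square of the
  coupling, which is 1 here.\<close>

lemma fib_trace_invariant:
  "(fib_trace E k)\<^sup>2 + (fib_trace E (Suc k))\<^sup>2 + (fib_trace E (Suc (Suc k)))\<^sup>2
     - fib_trace E k * fib_trace E (Suc k) * fib_trace E (Suc (Suc k)) = 5"
proof (induction k)
  case 0
  have eq: "fib_trace E (Suc (Suc 0)) = E * (E - 1) - 2" using fib_trace_init(3)[of E] by (simp add: numeral_2_eq_2)
  show ?case unfolding fib_trace_init eq by (simp add: power2_eq_square algebra_simps)
next
  case (Suc k)
  then show ?case unfolding fib_trace_rec by (simp add: power2_eq_square algebra_simps)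
qed

text \<open>At the first scale \<open>j\<close> above \<open>B\<close> the two preceding traces are
  still at most \<open>B\<close>. It suffices that the next trace exceeds 2, since from then on the
  recursion keeps growing. The scale right after a large trace may itself be small, hence
  \<open>i + 2\<close>.\<close>

lemma fib_trace_escape:
  assumes B: "B \<ge> 28" and E: "\<bar>E\<bar> \<le> 5" and gt: "\<bar>fib_trace E i\<bar> > B" and l: "l \<ge> i + 2"
  shows "\<bar>fib_trace E l\<bar> > B"
proof -
  define j where "j = (LEAST i. \<bar>fib_trace E i\<bar> > B)"
  have j: "\<bar>fib_trace E j\<bar> > B" unfolding j_def by (rule LeastI[of _ i]) (rule gt)
  have le: "\<bar>fib_trace E k\<bar> \<le> B" if "k < j" for k
    using that not_less_Least[of k "\<lambda>i. \<bar>fib_trace E i\<bar> > B"] unfolding j_def[symmetric] by force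
  have "j \<le> i" unfolding j_def by (rule Least_le) (rule gt)
  have EE: "\<bar>E * (E - 1)\<bar> \<le> 5 * 6" unfolding abs_mult using E by (intro mult_mono) auto
  have EE': "E * (E - 1) \<ge> - 1" using zero_le_power2[of "2 * E - 1"] by (simp add: power2_eq_square algebra_simps)
  have "\<bar>fib_trace E 0\<bar> \<le> B" "\<bar>fib_trace E 1\<bar> \<le> B" "\<bar>fib_trace E 2\<bar> \<le> B"
    using B E EE EE' fib_trace_init[of E] unfolding One_nat_def by linarith+
  then have "j \<noteq> 0" "j \<noteq> 1" "j \<noteq> 2"
    using j by (metis not_le)+
  then obtain m where m: "j = Suc (Suc (Suc m))"
    by (metis One_nat_def numeral_2_eq_2 not0_implies_Suc)
  define x0 x1 y z where "x0 = fib_trace E (Suc m)" and "x1 = fib_trace E (Suc (Suc m))" and "y = fib_trace E j" and "z = fib_trace E (Suc j)"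
  have b: "\<bar>x0\<bar> \<le> B" "\<bar>x1\<bar> \<le> B" "\<bar>y\<bar> > B"
    using le j m by (auto simp: x0_def x1_def y_def)
  have z: "z = y * x1 - x0" unfolding z_def y_def x0_def x1_def m by (rule fib_trace_rec)
  have inv: "x1\<^sup>2 + y\<^sup>2 + z\<^sup>2 - x1 * y * z = 5"
    using fib_trace_invariant[of E "Suc (Suc m)"] by (simp add: x1_def y_def z_def m)
  \<comment> \<open>If the trace before \<open>y\<close> exceeds 2, the recursion makes the one
    after \<open>y\<close> large. Otherwise the invariant forbids that both neighbours of a large
    trace be at most 2.\<close>
  have z2: "\<bar>z\<bar> > 2"
  proof (cases "\<bar>x1\<bar> > 2")
    case True
    then have "2 * \<bar>y\<bar> \<le> \<bar>x1\<bar> * \<bar>y\<bar>" by (intro mult_right_mono) auto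
    then have "\<bar>y * x1\<bar> \<ge> 2 * \<bar>y\<bar>" by (simp add: abs_mult mult.commute)
    then show ?thesis using z b B by linarith
  next
    case False
    show ?thesis
    proof (rule ccontr)
      assume "\<not> ?thesis"
      then have "\<bar>x1 * z\<bar> \<le> 2 * 2" unfolding abs_mult using False by (intro mult_mono) auto
      then have "\<bar>y\<bar> * \<bar>x1 * z\<bar> \<le> \<bar>y\<bar> * 4" by (intro mult_left_mono) auto
      then have "x1 * y * z \<le> 4 * \<bar>y\<bar>"
        using abs_ge_self[of "x1 * y * z"] by (simp add: abs_mult mult_ac)
      then have "y\<^sup>2 \<le> 5 + 4 * \<bar>y\<bar>" using inv by (smt (verit) zero_le_power2)
      moreover have "y\<^sup>2 \<ge> 28 * \<bar>y\<bar>"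
        using b B mult_right_mono[of 28 "\<bar>y\<bar>" "\<bar>y\<bar>"] by (simp add: power2_eq_square)
      ultimately show False using b B by linarith
    qed
  qed
  \<comment> \<open>The induction carries two neighbours: one above \<open>B\<close>, the preceding
    one only above 2 but no larger in absolute value.\<close>
  have main: "\<bar>fib_trace E (j + 2 + k)\<bar> > B \<and> \<bar>fib_trace E (j + 2 + k)\<bar> \<ge> \<bar>fib_trace E (j + k)\<bar>
     \<and> \<bar>fib_trace E (j + 1 + k)\<bar> > 2 \<and> \<bar>fib_trace E (j + 1 + k)\<bar> \<le> \<bar>fib_trace E (j + 2 + k)\<bar>" for k
  proof (induction k)
    case 0
    have w: "fib_trace E (j + 2) = z * y - x1"
      using fib_trace_rec[of E "Suc (Suc m)"] by (simp add: m z_def y_def x1_def)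
    have "2 * \<bar>y\<bar> \<le> \<bar>z * y\<bar>" "28 * \<bar>z\<bar> \<le> \<bar>z * y\<bar>"
      unfolding abs_mult using z2 b B mult_right_mono[of 2 "\<bar>z\<bar>" "\<bar>y\<bar>"] mult_left_mono[of 28 "\<bar>y\<bar>" "\<bar>z\<bar>"]
      by (auto simp: mult.commute)
    moreover have "\<bar>y\<bar> * 2 \<le> \<bar>y\<bar> * \<bar>z\<bar>" using z2 by (intro mult_left_mono) auto
    ultimately have "\<bar>fib_trace E (j + 2)\<bar> > B" "\<bar>fib_trace E (j + 2)\<bar> \<ge> \<bar>y\<bar>" "\<bar>fib_trace E (j + 2)\<bar> \<ge> \<bar>z\<bar>"
      unfolding w using b z2 by linarith+
    then show ?case using z2 by (simp add: z_def y_def)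
  next
    case (Suc k)
    have w: "fib_trace E (j + 2 + Suc k) = fib_trace E (j + 2 + k) * fib_trace E (j + 1 + k) - fib_trace E (j + k)"
      using fib_trace_rec[of E "j + k"] by simp
    have "\<bar>fib_trace E (j + 2 + k) * fib_trace E (j + 1 + k)\<bar> \<ge> \<bar>fib_trace E (j + 2 + k)\<bar> * 2"
      unfolding abs_mult using Suc by (intro mult_left_mono) auto
    then have "\<bar>fib_trace E (j + 2 + Suc k)\<bar> \<ge> \<bar>fib_trace E (j + 2 + k)\<bar>"
      unfolding w using Suc by linarith
    then show ?case using Suc B by auto
  qed
  have eq: "j + 2 + (l - j - 2) = l" using l \<open>j \<le> i\<close> by simp
  show ?thesis using main[of "l - j - 2", unfolded eq] by blast
qed

text \<open>The phases after which the next \<open>fib (Suc i)\<close> letters spell the $i$-th Fibonacci word. The description is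
  only correct for \<open>i \<ge> 3\<close>.\<close>
definition fib_range :: "nat \<Rightarrow> real \<Rightarrow> bool" where
  "fib_range i y \<longleftrightarrow> (if even i then - fib_dist i \<le> y \<and> y < fib_dist (i - 1) else - fib_dist (i - 1) \<le> y \<and> y < fib_dist i)"

section \<open>Fibonacci words read off from the phase\<close>

lemma fib_letter_eqI:
  assumes "phase \<theta> j = of_int z + y" 
    "\<lfloor>y + real (Suc m) * golden_alpha\<rfloor> = a" "\<lfloor>y + real (Suc (Suc m)) * golden_alpha\<rfloor> = b"
  shows "fib_letter \<theta> (j + 1 + int m) = of_int (b - a)"
proof -
  have *: "\<lfloor>phase \<theta> (j + int k)\<rfloor> = z + \<lfloor>y + real k * golden_alpha\<rfloor>" for k
  proof -
    have "phase \<theta> (j + int k) = of_int z + (y + real k * golden_alpha)"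
      unfolding phase_add assms(1) by simp
    then show ?thesis by simp
  qed
  show ?thesis
    using *[of "Suc m"] *[of "Suc (Suc m)"] assms(2,3)
    by (simp add: fib_letter_def algebra_simps)
qed

text \<open>The words are 101 and 10110. On the given phase intervals all floors are constant, which
  decides every letter.\<close>

lemma transfer_prod_fib_range_base:
  assumes y: "phase \<theta> j = of_int z + y"
  shows "fib_range 3 y \<Longrightarrow> transfer_prod (fib_letter \<theta>) E (j + 1) (fib 4) = fib_matrix E 3"
    and "fib_range 4 y \<Longrightarrow> transfer_prod (fib_letter \<theta>) E (j + 1) (fib 5) = fib_matrix E 4"
proof -
  note g = golden_alpha_bounds
  note w = fib_letter_eqI[OF y]
  show "transfer_prod (fib_letter \<theta>) E (j + 1) (fib 4) = fib_matrix E 3" if "fib_range 3 y"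
  proof -
    have r: "1 - 2 * golden_alpha \<le> y" "y < 2 - 3 * golden_alpha"
      using that by (simp_all add: fib_range_def fib_dist_values)
    have "\<lfloor>y + real (Suc 0) * golden_alpha\<rfloor> = 0" "\<lfloor>y + real (Suc (Suc 0)) * golden_alpha\<rfloor> = 1"
      "\<lfloor>y + real (Suc (Suc (Suc 0))) * golden_alpha\<rfloor> = 1"
      "\<lfloor>y + real (Suc (Suc (Suc (Suc 0)))) * golden_alpha\<rfloor> = 2"
      unfolding floor_eq_iff using g r by auto
    note f = this
    have "fib_letter \<theta> (j + 1) = 1" "fib_letter \<theta> (j + 2) = 0" "fib_letter \<theta> (j + 3) = 1"
      using w[OF f(1,2)] w[OF f(2,3)] w[OF f(3,4)] by (simp_all add: add.assoc)
    then show ?thesis by (simp add: eval_nat_numeral add.assoc matrix_mul_assoc)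
  qed
  show "transfer_prod (fib_letter \<theta>) E (j + 1) (fib 5) = fib_matrix E 4" if "fib_range 4 y"
  proof -
    have r: "3 - 5 * golden_alpha \<le> y" "y < 2 - 3 * golden_alpha"
      using that by (simp_all add: fib_range_def fib_dist_values)
    have "\<lfloor>y + real (Suc 0) * golden_alpha\<rfloor> = 0" "\<lfloor>y + real (Suc (Suc 0)) * golden_alpha\<rfloor> = 1"
      "\<lfloor>y + real (Suc (Suc (Suc 0))) * golden_alpha\<rfloor> = 1"
      "\<lfloor>y + real (Suc (Suc (Suc (Suc 0)))) * golden_alpha\<rfloor> = 2"
      "\<lfloor>y + real (Suc (Suc (Suc (Suc (Suc 0))))) * golden_alpha\<rfloor> = 3"
      "\<lfloor>y + real (Suc (Suc (Suc (Suc (Suc (Suc 0)))))) * golden_alpha\<rfloor> = 3"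
      unfolding floor_eq_iff using g r by auto
    note f = this
    have "fib_letter \<theta> (j + 1) = 1" "fib_letter \<theta> (j + 2) = 0" "fib_letter \<theta> (j + 3) = 1" "fib_letter \<theta> (j + 4) = 1" "fib_letter \<theta> (j + 5) = 0"
      using w[OF f(1,2)] w[OF f(2,3)] w[OF f(3,4)] w[OF f(4,5)] w[OF f(5,6)] by (simp_all add: add.assoc)
    then show ?thesis by (simp add: eval_nat_numeral add.assoc matrix_mul_assoc)
  qed
qed

text \<open>The phase version of the word recursion: the longer word begins with the word of level
  \<open>Suc i\<close>, and reading it moves the phase by \<open>fib_disp (Suc i)\<close> into the
  range of the word of level \<open>i\<close>.\<close>

lemma fib_range_step:
  assumes "fib_range (Suc (Suc i)) y" "1 \<le> i"
  shows "fib_range (Suc i) y" "fib_range i (y + fib_disp (Suc i))"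
proof -
  obtain k where k: "i = Suc k" using assms by (cases i) auto
  note f = fib_dist_rec[of i] fib_dist_rec[of "i - 1"] fib_dist_pos[of i] fib_dist_pos[of "Suc i"] fib_dist_pos[of "Suc (Suc i)"] fib_dist_rec[of k] fib_dist_pos[of k]
  show "fib_range (Suc i) y" "fib_range i (y + fib_disp (Suc i))"
    using assms f unfolding fib_range_def fib_disp_def k by (auto split: if_splits)
qed

lemma transfer_prod_fib_range:
  assumes "3 \<le> i" "phase \<theta> j = of_int z + y" "fib_range i y"
  shows "transfer_prod (fib_letter \<theta>) E (j + 1) (fib (Suc i)) = fib_matrix E i"
  using assms
proof (induction i arbitrary: j z y rule: less_induct)
  case (less i)
  consider "i = 3" | "i = 4" | "i \<ge> 5" using less.prems(1) by linarith
  then show ?case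
  proof cases
    case 3
    then obtain k where k: "i = Suc (Suc k)" "3 \<le> k"
      by (intro that[of "i - 2"]) auto
    have "fib_range (Suc k) y" "fib_range k (y + fib_disp (Suc k))"
      using fib_range_step[of k y] less.prems k by auto
    then have 1: "transfer_prod (fib_letter \<theta>) E (j + 1) (fib (Suc (Suc k))) = fib_matrix E (Suc k)"
      using less.IH[of "Suc k" j z y] less.prems k by auto
    have "phase \<theta> (j + int (fib (Suc (Suc k)))) = of_int (z + int (fib (Suc k))) + (y + fib_disp (Suc k))"
      using fib_golden_alpha[of "Suc k"] less.prems(2) by (simp add: phase_add del: fib.simps)
    then have 2: "transfer_prod (fib_letter \<theta>) E (j + int (fib (Suc (Suc k))) + 1) (fib (Suc k)) = fib_matrix E k"
      using \<open>fib_range k _\<close> k less.IH[of k "j + int (fib (Suc (Suc k)))" "z + int (fib (Suc k))"]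
      by (simp del: fib.simps)
    have "fib (Suc i) = fib (Suc (Suc k)) + fib (Suc k)" by (simp add: k)
    then have "transfer_prod (fib_letter \<theta>) E (j + 1) (fib (Suc i)) =
        transfer_prod (fib_letter \<theta>) E (j + 1 + int (fib (Suc (Suc k)))) (fib (Suc k)) ** transfer_prod (fib_letter \<theta>) E (j + 1) (fib (Suc (Suc k)))"
      by (simp only: transfer_prod_add)
    also have "\<dots> = fib_matrix E i"
      using 1 2 by (simp add: k add_ac del: fib.simps)
    finally show ?thesis .
  qed (use transfer_prod_fib_range_base[of \<theta> j z y E] less.prems in \<open>auto simp: numeral_eq_Suc\<close>)
qed

text \<open>Away from defects, shifting a window by one site conjugates its transfer matrix, and right after a
  defect the window is the Fibonacci word itself.\<close>
lemma trace_transfer_prod_fib: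
  assumes i: "3 \<le> i" and n: "\<not> fib_defect \<theta> i n"
  shows "trace (transfer_prod (fib_letter \<theta>) E n (fib (Suc i))) = fib_trace E i"
proof -
  have "\<exists>k. fib_defect \<theta> i (n - int k)"
  proof -
    obtain j where "j \<le> n" "fib_defect \<theta> i j" using ex_fib_defect_le by blast
    then show ?thesis by (intro exI[of _ "nat (n - j)"]) simp
  qed
  then have "fib_defect \<theta> i (n - int (LEAST k. fib_defect \<theta> i (n - int k)))" (is "fib_defect \<theta> i (n - int ?k)")
    by (rule LeastI_ex)
  have k: "fib_defect \<theta> i (n - int ?k)" by fact
  have less: "\<not> fib_defect \<theta> i (n - int k)" if "k < ?k" for k using not_less_Least that by fast
  have "?k > 0" using k n by (cases ?k) auto
  then obtain K where K: "?k = Suc K" by (cases ?k) auto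
  have 1: "trace (transfer_prod (fib_letter \<theta>) E (n - int K) (fib (Suc i))) = fib_trace E i"
  proof -
    define j where "j = n - int ?k"
    have j: "fib_defect \<theta> i j" using k by (simp add: j_def)
    \<comment> \<open>A defect phase lies in the part of the range of length
      \<open>fib_dist i\<close>, on the side of the integer given by the parity.\<close>
    obtain z :: int where "fib_range i (phase \<theta> j - z)"
    proof (cases "even i")
      case True
      then obtain z :: int where "- fib_dist i \<le> phase \<theta> j - z" "phase \<theta> j - z < 0"
        using j by (auto simp: fib_defect_even_iff)
      then show ?thesis using that[of z] True fib_dist_pos[of "i - 1"] by (simp add: fib_range_def)
    next
      case False
      then obtain z :: int where "0 \<le> phase \<theta> j - z" "phase \<theta> j - z < fib_dist i"
        using j by (auto simp: fib_defect_odd_iff)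
      then show ?thesis using that[of z] False fib_dist_pos[of "i - 1"] by (simp add: fib_range_def)
    qed
    then have "transfer_prod (fib_letter \<theta>) E (j + 1) (fib (Suc i)) = fib_matrix E i"
      using i by (intro transfer_prod_fib_range[of i \<theta> j z]) auto
    then show ?thesis unfolding j_def K by (simp add: fib_trace_def algebra_simps del: fib.simps)
  qed
  have "trace (transfer_prod (fib_letter \<theta>) E (n - int k) (fib (Suc i))) = fib_trace E i" if "k \<le> K" for k
    using that
  proof (induction rule: inc_induct)
    case base
    show ?case by (rule 1)
  next
    case (step m)
    have "fib_letter \<theta> ((n - int (Suc m)) + int (fib (Suc i))) = fib_letter \<theta> (n - int (Suc m))"
      using less[of "Suc m"] less[of m] step.hyps K
      by (intro fib_letter_add_fib) auto
    then have "trace (transfer_prod (fib_letter \<theta>) E (n - int (Suc m) + 1) (fib (Suc i))) = fib_trace E i"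
      using step.IH by (simp only: trace_transfer_prod_shift)
    then show ?case by simp
  qed
  from this[of 0] show ?thesis by simp
qed

lemma defect_free_square:
  assumes i: "3 \<le> i" and n: "defect_free \<theta> i n"
  defines "q \<equiv> fib (Suc i)"
  shows "transfer_prod (fib_letter \<theta>) E (n + int q) q = transfer_prod (fib_letter \<theta>) E n q"
    and "trace (transfer_prod (fib_letter \<theta>) E n q) = fib_trace E i"
proof -
  show "trace (transfer_prod (fib_letter \<theta>) E n q) = fib_trace E i"
    unfolding q_def by (rule trace_transfer_prod_fib) (use assms in \<open>auto simp: defect_free_def\<close>)
  show "transfer_prod (fib_letter \<theta>) E (n + int q) q = transfer_prod (fib_letter \<theta>) E n q"
  proof (rule transfer_prod_cong)
    fix k assume "k < q"
    then have "fib_letter \<theta> (n + int k + int (fib (Suc i))) = fib_letter \<theta> (n + int k)"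
      using n by (intro fib_letter_add_fib) (auto simp: defect_free_def q_def simp del: fib.simps)
    then show "fib_letter \<theta> (n + int q + int k) = fib_letter \<theta> (n + int k)"
      by (simp add: q_def add_ac del: fib.simps)
  qed
qed

subsection \<open>The Jacobi operator on square-summable sequences\<close>

definition sqsum :: "(nat \<Rightarrow> real) \<Rightarrow> real" where
  "sqsum u = (\<Sum>k. (u k)\<^sup>2)"

definition ell2_inner :: "(nat \<Rightarrow> real) \<Rightarrow> (nat \<Rightarrow> real) \<Rightarrow> real" where
  "ell2_inner u w = (\<Sum>k. u k * w k)"

lemma summable_comparison_nonneg:
  fixes f g :: "nat \<Rightarrow> real"
  assumes "summable g" "\<And>k. 0 \<le> f k" "\<And>k. f k \<le> g k"
  shows "summable f"
  by (rule summable_comparison_test'[OF assms(1), of 0]) (use assms in auto)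

lemma summable_shift:
  fixes f :: "nat \<Rightarrow> real"
  assumes "summable f" "\<And>n. 0 \<le> f n"
  shows "summable (\<lambda>n. f (n + a))" "(\<Sum>n. f (n + a)) \<le> suminf f"
proof -
  show "summable (\<lambda>n. f (n + a))" using assms(1) by (simp add: summable_iff_shift)
  show "(\<Sum>n. f (n + a)) \<le> suminf f"
    using suminf_split_initial_segment[OF assms(1), of a] assms(2) by (simp add: sum_nonneg)
qed

lemma ell2_summable_mult:
  assumes "u \<in> ell2" "w \<in> ell2"
  shows "summable (\<lambda>k. u k * w k)"
proof (rule summable_rabs_cancel, rule summable_comparison_nonneg)
  show "summable (\<lambda>k. (u k)\<^sup>2 + (w k)\<^sup>2)"
    using assms by (auto simp: ell2_def intro: summable_add)
  show "\<bar>u k * w k\<bar> \<le> (u k)\<^sup>2 + (w k)\<^sup>2" for k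
  proof -
    have "2 * \<bar>u k * w k\<bar> \<le> (u k)\<^sup>2 + (w k)\<^sup>2"
      using sum_squares_bound[of "\<bar>u k\<bar>" "\<bar>w k\<bar>"] by (simp add: abs_mult mult.assoc)
    then show ?thesis using abs_ge_zero[of "u k * w k"] by linarith
  qed
qed auto

lemma ell2_lincomb:
  assumes "u \<in> ell2" "w \<in> ell2"
  shows "(\<lambda>k. a * u k + c * w k) \<in> ell2"
    and "sqsum (\<lambda>k. a * u k + c * w k) = a\<^sup>2 * sqsum u + 2 * a * c * ell2_inner u w + c\<^sup>2 * sqsum w"
proof -
  have *: "(\<lambda>k. a\<^sup>2 * (u k)\<^sup>2 + 2 * a * c * (u k * w k) + c\<^sup>2 * (w k)\<^sup>2) sums
      (a\<^sup>2 * sqsum u + 2 * a * c * ell2_inner u w + c\<^sup>2 * sqsum w)"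
    unfolding sqsum_def ell2_inner_def
    using assms ell2_summable_mult[OF assms]
    by (intro sums_add sums_mult summable_sums) (auto simp: ell2_def)
  have eq: "(\<lambda>k. (a * u k + c * w k)\<^sup>2) = (\<lambda>k. a\<^sup>2 * (u k)\<^sup>2 + 2 * a * c * (u k * w k) + c\<^sup>2 * (w k)\<^sup>2)"
    by (auto simp: power2_eq_square algebra_simps)
  show "(\<lambda>k. a * u k + c * w k) \<in> ell2"
    unfolding ell2_def mem_Collect_eq eq using * by (rule sums_summable)
  show "sqsum (\<lambda>k. a * u k + c * w k) = a\<^sup>2 * sqsum u + 2 * a * c * ell2_inner u w + c\<^sup>2 * sqsum w"
    unfolding sqsum_def[of "\<lambda>k. a * u k + c * w k"] eq using * by (rule sums_unique[symmetric])
qed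

lemma sqsum_nonneg: "u \<in> ell2 \<Longrightarrow> 0 \<le> sqsum u"
  unfolding sqsum_def ell2_def by (intro suminf_nonneg) auto

lemma sum_le_sqsum: "u \<in> ell2 \<Longrightarrow> finite F \<Longrightarrow> (\<Sum>k\<in>F. (u k)\<^sup>2) \<le> sqsum u"
  unfolding sqsum_def ell2_def by (intro sum_le_suminf) auto

lemma ell2_member_le: "u \<in> ell2 \<Longrightarrow> (u k)\<^sup>2 \<le> sqsum u"
  using sum_le_sqsum[of u "{k}"] by simp

lemma sqsum_zero_imp:
  assumes "u \<in> ell2" "sqsum u \<le> 0"
  shows "u = (\<lambda>_. 0)"
proof
  fix k
  have "(u k)\<^sup>2 \<le> 0" using ell2_member_le[OF assms(1), of k] assms(2) by linarith
  then show "u k = 0" by simp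
qed

definition shift_down :: "(nat \<Rightarrow> real) \<Rightarrow> nat \<Rightarrow> real" where
  "shift_down u = (\<lambda>k. if k = 0 then 0 else u (k - 1))"

lemma shift_up_ell2:
  assumes "u \<in> ell2"
  shows "(\<lambda>k. u (Suc k)) \<in> ell2" "sqsum (\<lambda>k. u (Suc k)) \<le> sqsum u"
proof -
  have s: "summable (\<lambda>k. (u k)\<^sup>2)" using assms by (simp add: ell2_def)
  then show "(\<lambda>k. u (Suc k)) \<in> ell2" by (simp add: ell2_def summable_Suc_iff[of "\<lambda>k. (u k)\<^sup>2"])
  show "sqsum (\<lambda>k. u (Suc k)) \<le> sqsum u"
    unfolding sqsum_def using suminf_split_head[OF s] by simp
qed

lemma shift_down_ell2:
  assumes "u \<in> ell2"
  shows "shift_down u \<in> ell2" "sqsum (shift_down u) = sqsum u"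
proof -
  have s: "summable (\<lambda>k. (u k)\<^sup>2)" using assms by (simp add: ell2_def)
  have *: "summable (\<lambda>k. (shift_down u k)\<^sup>2)"
    using s summable_Suc_iff[of "\<lambda>k. (shift_down u k)\<^sup>2"] by (simp add: shift_down_def)
  then show "shift_down u \<in> ell2" by (simp add: ell2_def)
  show "sqsum (shift_down u) = sqsum u"
    unfolding sqsum_def using suminf_split_head[OF *] by (simp add: shift_down_def)
qed

lemma ell2_inner_shift:
  assumes "u \<in> ell2" "w \<in> ell2"
  shows "ell2_inner (\<lambda>k. u (Suc k)) w = ell2_inner u (shift_down w)"
proof -
  have "summable (\<lambda>k. u k * shift_down w k)"
    using assms by (intro ell2_summable_mult shift_down_ell2)
  from suminf_split_head[OF this] show ?thesis by (simp add: ell2_inner_def shift_down_def)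
qed

text \<open>Completeness for absolutely convergent series: the square root of \<open>q\<close> is a
  geometric ratio for the norms, Minkowski's inequality bounds the partial sums uniformly on each
  finite window, and the bound passes to the pointwise limit.\<close>

lemma ell2_of_geometric:
  fixes w :: "nat \<Rightarrow> nat \<Rightarrow> real"
  assumes w: "\<And>j. w j \<in> ell2" "\<And>j. sqsum (w j) \<le> q ^ j * C" and q: "0 \<le> q" "q < 1"
  obtains u where "u \<in> ell2" "\<And>k. (\<lambda>j. w j k) sums u k"
proof -
  define r where "r = sqrt q"
  have r: "0 \<le> r" "r < 1" using q by (auto simp: r_def)
  have C: "0 \<le> C" using w(2)[of 0] sqsum_nonneg[OF w(1)[of 0]] by simp
  have L2: "L2_set (w j) {..<K} \<le> r ^ j * sqrt C" for j K
  proof -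
    have "(\<Sum>k<K. (w j k)\<^sup>2) \<le> q ^ j * C"
      using sum_le_sqsum[OF w(1), of "{..<K}" j] w(2)[of j] by simp
    then have "L2_set (w j) {..<K} \<le> sqrt (q ^ j * C)"
      unfolding L2_set_def by (rule real_sqrt_le_mono)
    then show ?thesis by (simp add: r_def real_sqrt_mult real_sqrt_power)
  qed
  have "\<bar>w j k\<bar> \<le> r ^ j * sqrt C" for j k
    using order_trans[OF member_le_L2_set[of "{..<Suc k}" k "\<lambda>i. \<bar>w j i\<bar>"]] L2[of j "Suc k"]
    by (simp add: L2_set_def)
  moreover have gs: "summable (\<lambda>j. r ^ j * sqrt C)"
    using r by (intro summable_mult2 summable_geometric) auto
  ultimately have sm: "summable (\<lambda>j. w j k)" for k
    by (intro summable_comparison_test'[OF gs, of 0]) auto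
  define u where "u k = (\<Sum>j. w j k)" for k
  have sums: "(\<lambda>j. w j k) sums u k" for k unfolding u_def using sm by (rule summable_sums)
  define D where "D = (\<Sum>j. r ^ j * sqrt C)"
  have part: "L2_set (\<lambda>k. \<Sum>j<N. w j k) {..<K} \<le> (\<Sum>j<N. r ^ j * sqrt C)" for N K
  proof (induction N)
    case (Suc N)
    have "L2_set (\<lambda>k. \<Sum>j<Suc N. w j k) {..<K} \<le> L2_set (\<lambda>k. \<Sum>j<N. w j k) {..<K} + L2_set (w N) {..<K}"
      using L2_set_triangle_ineq[of "\<lambda>k. \<Sum>j<N. w j k" "w N" "{..<K}"] by simp
    then show ?case using Suc L2[of N K] by simp
  qed (simp add: L2_set_def)
  have "(\<Sum>k<K. (u k)\<^sup>2) \<le> D\<^sup>2" for K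
  proof (rule LIMSEQ_le_const2)
    show "(\<lambda>N. \<Sum>k<K. (\<Sum>j<N. w j k)\<^sup>2) \<longlonglongrightarrow> (\<Sum>k<K. (u k)\<^sup>2)"
      using sums by (intro tendsto_sum tendsto_power) (simp add: sums_def)
    have "(\<Sum>k<K. (\<Sum>j<N. w j k)\<^sup>2) \<le> D\<^sup>2" for N
    proof -
      have "sqrt (\<Sum>k<K. (\<Sum>j<N. w j k)\<^sup>2) \<le> D"
        using part[of N K] sum_le_suminf[OF gs, of "{..<N}"] r C by (simp add: L2_set_def D_def)
      then show ?thesis by (rule sqrt_le_D)
    qed
    then show "\<exists>N. \<forall>n\<ge>N. (\<Sum>k<K. (\<Sum>j<n. w j k)\<^sup>2) \<le> D\<^sup>2" by blast
  qed
  then have "summable (\<lambda>k. (u k)\<^sup>2)"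
    by (intro summableI_nonneg_bounded[of _ "D\<^sup>2"]) auto
  then have "u \<in> ell2" by (simp add: ell2_def)
  then show thesis using that sums by blast
qed

section \<open>The Jacobi operator: boundedness, symmetry, bijectivity\<close>

locale bounded_potential =
  fixes b :: "nat \<Rightarrow> real"
  assumes b_bound: "\<bar>b n\<bar> \<le> 1"
begin

definition shifted_J :: "real \<Rightarrow> (nat \<Rightarrow> real) \<Rightarrow> nat \<Rightarrow> real" where
  "shifted_J x u = (\<lambda>k. jacobi_op (\<lambda>_. 1) b u k - x * u k)"

lemma shifted_J_eq: "shifted_J x u k = u (Suc k) + (b (Suc k) - x) * u k + shift_down u k"
  by (simp add: shifted_J_def jacobi_op_def shift_down_def algebra_simps)

lemma shifted_J_bound:
  assumes "u \<in> ell2"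
  shows "shifted_J x u \<in> ell2" "sqsum (shifted_J x u) \<le> 3 * (2 + (1 + \<bar>x\<bar>)\<^sup>2) * sqsum u"
proof -
  define g where "g = (\<lambda>k. 3 * ((u (Suc k))\<^sup>2 + (1 + \<bar>x\<bar>)\<^sup>2 * (u k)\<^sup>2 + (shift_down u k)\<^sup>2))"
  have su: "summable (\<lambda>k. (u k)\<^sup>2)" "summable (\<lambda>k. (u (Suc k))\<^sup>2)" "summable (\<lambda>k. (shift_down u k)\<^sup>2)"
    using assms shift_up_ell2[OF assms] shift_down_ell2[OF assms] by (auto simp: ell2_def)
  have gs: "g sums (3 * (sqsum (\<lambda>k. u (Suc k)) + (1 + \<bar>x\<bar>)\<^sup>2 * sqsum u + sqsum (shift_down u)))"
    unfolding g_def sqsum_def by (intro sums_mult sums_add summable_sums su)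
  have le: "(shifted_J x u k)\<^sup>2 \<le> g k" for k
  proof -
    have "(p + q + r)\<^sup>2 \<le> 3 * (p\<^sup>2 + q\<^sup>2 + r\<^sup>2)" for p q r :: real
    proof -
      have "3 * (p\<^sup>2 + q\<^sup>2 + r\<^sup>2) - (p + q + r)\<^sup>2 = (p - q)\<^sup>2 + (q - r)\<^sup>2 + (p - r)\<^sup>2"
        by (simp add: power2_eq_square algebra_simps)
      also have "\<dots> \<ge> 0" by simp
      finally show ?thesis by simp
    qed
    then have "(shifted_J x u k)\<^sup>2 \<le> 3 * ((u (Suc k))\<^sup>2 + ((b (Suc k) - x) * u k)\<^sup>2 + (shift_down u k)\<^sup>2)"
      by (simp only: shifted_J_eq)
    also have "((b (Suc k) - x) * u k)\<^sup>2 \<le> (1 + \<bar>x\<bar>)\<^sup>2 * (u k)\<^sup>2"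
    proof -
      have "\<bar>b (Suc k) - x\<bar> \<le> \<bar>1 + \<bar>x\<bar>\<bar>" using b_bound[of "Suc k"] by linarith
      then show ?thesis unfolding power_mult_distrib
        by (intro mult_right_mono) (simp_all only: abs_le_square_iff zero_le_power2)
    qed
    finally show ?thesis by (simp add: g_def)
  qed
  have s: "summable (\<lambda>k. (shifted_J x u k)\<^sup>2)"
    by (rule summable_comparison_nonneg[OF sums_summable[OF gs]]) (use le in auto)
  then show "shifted_J x u \<in> ell2" by (simp add: ell2_def)
  have "sqsum (shifted_J x u) \<le> suminf g"
    unfolding sqsum_def using le s sums_summable[OF gs] by (intro suminf_le) auto
  also have "\<dots> = 3 * (sqsum (\<lambda>k. u (Suc k)) + (1 + \<bar>x\<bar>)\<^sup>2 * sqsum u + sqsum (shift_down u))"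
    using gs by (rule sums_unique[symmetric])
  also have "\<dots> \<le> 3 * (2 + (1 + \<bar>x\<bar>)\<^sup>2) * sqsum u"
    using shift_up_ell2[OF assms] shift_down_ell2[OF assms] by (simp add: algebra_simps)
  finally show "sqsum (shifted_J x u) \<le> 3 * (2 + (1 + \<bar>x\<bar>)\<^sup>2) * sqsum u" .
qed

lemma shifted_J_symmetric:
  assumes u: "u \<in> ell2" and w: "w \<in> ell2"
  shows "ell2_inner (shifted_J x u) w = ell2_inner u (shifted_J x w)"
proof -
  have bw: "(\<lambda>k. (b (Suc k) - x) * v k) \<in> ell2" if "v \<in> ell2" for v
  proof -
    have "shifted_J x v \<in> ell2" "(\<lambda>k. v (Suc k)) \<in> ell2" "shift_down v \<in> ell2"
      using that by (auto intro: shifted_J_bound shift_up_ell2 shift_down_ell2)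
    then have "(\<lambda>k. 1 * shifted_J x v k + (-1) * v (Suc k)) \<in> ell2" by (intro ell2_lincomb)
    then have "(\<lambda>k. 1 * (1 * shifted_J x v k + (-1) * v (Suc k)) + (-1) * shift_down v k) \<in> ell2"
      using \<open>shift_down v \<in> ell2\<close> by (rule ell2_lincomb)
    then show ?thesis by (simp add: shifted_J_eq)
  qed
  have "(\<lambda>k. u (Suc k) * w k + (b (Suc k) - x) * u k * w k + shift_down u k * w k) sums
      (ell2_inner (\<lambda>k. u (Suc k)) w + ell2_inner (\<lambda>k. (b (Suc k) - x) * u k) w + ell2_inner (shift_down u) w)"
    unfolding ell2_inner_def
    by (intro sums_add summable_sums ell2_summable_mult u w bw shift_up_ell2 shift_down_ell2)
  moreover have "(\<lambda>k. u (Suc k) * w k + (b (Suc k) - x) * u k * w k + shift_down u k * w k) = (\<lambda>k. shifted_J x u k * w k)"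
    by (simp add: shifted_J_eq algebra_simps)
  ultimately have 1: "ell2_inner (shifted_J x u) w = ell2_inner (\<lambda>k. u (Suc k)) w
      + ell2_inner (\<lambda>k. (b (Suc k) - x) * u k) w + ell2_inner (shift_down u) w"
    unfolding ell2_inner_def[of "shifted_J x u"] by (simp add: sums_iff)
  have "(\<lambda>k. u k * w (Suc k) + u k * ((b (Suc k) - x) * w k) + u k * shift_down w k) sums
      (ell2_inner u (\<lambda>k. w (Suc k)) + ell2_inner u (\<lambda>k. (b (Suc k) - x) * w k) + ell2_inner u (shift_down w))"
    unfolding ell2_inner_def
    by (intro sums_add summable_sums ell2_summable_mult u w bw shift_up_ell2 shift_down_ell2)
  moreover have "(\<lambda>k. u k * w (Suc k) + u k * ((b (Suc k) - x) * w k) + u k * shift_down w k) = (\<lambda>k. u k * shifted_J x w k)"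
    by (simp add: shifted_J_eq algebra_simps)
  ultimately have 2: "ell2_inner u (shifted_J x w) = ell2_inner u (\<lambda>k. w (Suc k))
      + ell2_inner u (\<lambda>k. (b (Suc k) - x) * w k) + ell2_inner u (shift_down w)"
    unfolding ell2_inner_def[of u "shifted_J x w"] by (simp add: sums_iff)
  have 3: "ell2_inner u v = ell2_inner v u" for u v by (simp add: ell2_inner_def mult.commute)
  have "ell2_inner (\<lambda>k. (b (Suc k) - x) * u k) w = ell2_inner u (\<lambda>k. (b (Suc k) - x) * w k)"
    by (simp add: ell2_inner_def mult_ac)
  then show ?thesis
    unfolding 1 2 ell2_inner_shift[OF u w] using ell2_inner_shift[OF w u] 3 by simp
qed

lemma shifted_J_diff: "shifted_J x (\<lambda>k. u k - v k) = (\<lambda>k. shifted_J x u k - shifted_J x v k)"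
  by (rule ext) (simp add: shifted_J_eq shift_down_def algebra_simps)

lemma shifted_J_sums:
  assumes "\<And>k. (\<lambda>j. w j k) sums u k"
  shows "(\<lambda>j. shifted_J x (w j) k) sums shifted_J x u k"
proof -
  have "(\<lambda>j. shift_down (w j) k) sums shift_down u k"
    using assms by (auto simp: shift_down_def)
  then show ?thesis unfolding shifted_J_eq by (intro sums_add sums_mult assms)
qed

text \<open>Surjectivity by Richardson iteration for the normal equation: by symmetry, $1 - t (J - x)^2$ is a
  contraction for small $t > 0$.\<close>
lemma bij_shifted_J_of_bounded_below:
  assumes c: "c > 0" and below: "\<And>u. u \<in> ell2 \<Longrightarrow> c * sqsum u \<le> sqsum (shifted_J x u)"
  shows "bij_betw (shifted_J x) ell2 ell2"
proof -
  have ker: "u = (\<lambda>_. 0)" if "u \<in> ell2" "shifted_J x u = (\<lambda>_. 0)" for u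
  proof (rule sqsum_zero_imp)
    have "c * sqsum u \<le> 0" using below[OF that(1)] that(2) by (simp add: sqsum_def)
    then show "sqsum u \<le> 0" using c by (simp add: mult_le_0_iff)
  qed fact
  have diff: "(\<lambda>k. u k - v k) \<in> ell2" if "u \<in> ell2" "v \<in> ell2" for u v
    using ell2_lincomb(1)[OF that, of 1 "-1"] by simp
  have inj: "u = v" if "u \<in> ell2" "v \<in> ell2" "shifted_J x u = shifted_J x v" for u v
  proof -
    have "(\<lambda>k. u k - v k) = (\<lambda>_. 0)" 
    proof (rule ker)
      show "(\<lambda>k. u k - v k) \<in> ell2" using that by (intro diff)
      show "shifted_J x (\<lambda>k. u k - v k) = (\<lambda>_. 0)" using that(3) by (simp add: shifted_J_diff)
    qed
    then show ?thesis by (auto simp: fun_eq_iff)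
  qed
  have surj: "\<exists>u\<in>ell2. shifted_J x u = f" if f: "f \<in> ell2" for f
  proof -
    \<comment> \<open>An upper bound for the squared operator norm; adding \<open>c\<close> secures
      \<open>C \<ge> c\<close>, which puts the contraction factor \<open>1 - c * t\<close> into
      [0,1).\<close>
    define C where "C = 3 * (2 + (1 + \<bar>x\<bar>)\<^sup>2) + c"
    have C: "C > 0" "C \<ge> c" unfolding C_def using c by (auto intro!: add_nonneg_pos)
    have above: "sqsum (shifted_J x u) \<le> C * sqsum u" if "u \<in> ell2" for u
    proof -
      have "0 \<le> c * sqsum u" using sqsum_nonneg[OF that] c by simp
      then show ?thesis using shifted_J_bound(2)[OF that, of x] unfolding C_def distrib_right by linarith
    qed
    define t where "t = 1 / C"
    define Bop where "Bop w = (\<lambda>k. 1 * w k + (- t) * shifted_J x (shifted_J x w) k)" for w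
    have Bop: "Bop w \<in> ell2" "sqsum (Bop w) \<le> (1 - c * t) * sqsum w" if w: "w \<in> ell2" for w
    proof -
      have Aw: "shifted_J x w \<in> ell2" "shifted_J x (shifted_J x w) \<in> ell2" using w shifted_J_bound by auto
      show "Bop w \<in> ell2" unfolding Bop_def by (intro ell2_lincomb w Aw)
      have "sqsum (Bop w) = sqsum w - 2 * t * ell2_inner w (shifted_J x (shifted_J x w)) + t\<^sup>2 * sqsum (shifted_J x (shifted_J x w))"
        unfolding Bop_def using ell2_lincomb(2)[OF w Aw(2), of 1 "- t"] by simp
      also have "ell2_inner w (shifted_J x (shifted_J x w)) = sqsum (shifted_J x w)"
        unfolding shifted_J_symmetric[OF w Aw(1), symmetric] by (simp add: ell2_inner_def sqsum_def power2_eq_square)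
      also have "sqsum w - 2 * t * sqsum (shifted_J x w) + t\<^sup>2 * sqsum (shifted_J x (shifted_J x w)) \<le>
          sqsum w - 2 * t * sqsum (shifted_J x w) + t\<^sup>2 * (C * sqsum (shifted_J x w))"
        using above[OF Aw(1)] by (intro add_left_mono mult_left_mono) auto
      also have "\<dots> = sqsum w - t * sqsum (shifted_J x w)"
        using C by (simp add: t_def power2_eq_square field_simps)
      also have "\<dots> \<le> sqsum w - t * (c * sqsum w)"
        using below[OF w] C by (intro diff_left_mono mult_left_mono) (auto simp: t_def)
      finally show "sqsum (Bop w) \<le> (1 - c * t) * sqsum w" by (simp add: algebra_simps)
    qed
    have q: "0 \<le> 1 - c * t" "1 - c * t < 1" using C c by (auto simp: t_def field_simps)
    define g where "g = (\<lambda>k. t * shifted_J x f k)"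
    have g: "g \<in> ell2"
      using ell2_lincomb(1)[OF shifted_J_bound(1)[OF f] shifted_J_bound(1)[OF f], of t x 0 x] by (simp add: g_def)
    define w where "w j = (Bop ^^ j) g" for j
    have w: "w j \<in> ell2 \<and> sqsum (w j) \<le> (1 - c * t) ^ j * sqsum g" for j
    proof (induction j)
      case (Suc j)
      have "sqsum (w (Suc j)) \<le> (1 - c * t) * sqsum (w j)"
        using Suc Bop(2)[of "w j"] by (simp add: w_def)
      also have "\<dots> \<le> (1 - c * t) * ((1 - c * t) ^ j * sqsum g)"
        using Suc q by (intro mult_left_mono) auto
      finally show ?case using Suc Bop(1)[of "w j"] by (simp add: w_def algebra_simps)
    qed (use g in \<open>simp add: w_def\<close>)
    obtain u where u: "u \<in> ell2" "\<And>k. (\<lambda>j. w j k) sums u k"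
      using ell2_of_geometric[of w "1 - c * t" "sqsum g"] w q by blast
    \<comment> \<open>Dropping the first term \<open>g\<close> of the Neumann series for
      \<open>u\<close> amounts to applying \<open>Bop\<close>. This is the normal equation, from
      which injectivity then cancels one factor of the operator.\<close>
    have "t * shifted_J x (shifted_J x u) k = t * shifted_J x f k" for k
    proof -
      have "(\<lambda>j. 1 * w j k + (- t) * shifted_J x (shifted_J x (w j)) k) sums (1 * u k + (- t) * shifted_J x (shifted_J x u) k)"
        by (intro sums_add sums_mult u shifted_J_sums)
      then have "(\<lambda>j. w (Suc j) k) sums (u k - t * shifted_J x (shifted_J x u) k)"
        by (simp add: w_def Bop_def)
      then have "(\<lambda>j. w j k) sums (u k - t * shifted_J x (shifted_J x u) k + w 0 k)"
        by (rule sums_Suc)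
      from sums_unique2[OF this u(2)] show ?thesis by (auto simp: w_def g_def)
    qed
    then have "shifted_J x (shifted_J x u) = shifted_J x f" using C by (auto simp: t_def)
    then have "shifted_J x u = f" using u f shifted_J_bound by (intro inj[of "shifted_J x u" f]) auto
    then show ?thesis using u by blast
  qed
  show ?thesis
    unfolding bij_betw_def inj_on_def using inj surj shifted_J_bound(1) by blast
qed

lemma spectrum_iff: "x \<in> jacobi_spectrum (\<lambda>_. 1) b \<longleftrightarrow> \<not> bij_betw (shifted_J x) ell2 ell2"
  by (simp add: jacobi_spectrum_def shifted_J_def[abs_def])

text \<open>Write $x u$ as $J u - (J - x) u$. The squared norm of $J$ is at most 9, and the
  inequality for the square of a sum doubles it to 18, below 25, so $J - x$ is bounded
  below.\<close>

lemma spectrum_bounded: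
  assumes "x \<in> jacobi_spectrum (\<lambda>_. 1) b"
  shows "\<bar>x\<bar> \<le> 5"
proof (rule ccontr)
  assume "\<not> ?thesis"
  then have "5\<^sup>2 < \<bar>x\<bar>\<^sup>2" by (intro power_strict_mono) auto
  then have x: "25 < x\<^sup>2" by simp
  have "1 * sqsum u \<le> sqsum (shifted_J x u)" if u: "u \<in> ell2" for u
  proof -
    have A: "shifted_J x u \<in> ell2" "shifted_J 0 u \<in> ell2" using shifted_J_bound u by auto
    have "(\<lambda>k. x * u k) = (\<lambda>k. 1 * shifted_J 0 u k + (-1) * shifted_J x u k)"
      by (auto simp: shifted_J_eq algebra_simps)
    then have "x\<^sup>2 * sqsum u = sqsum (shifted_J 0 u) - 2 * ell2_inner (shifted_J 0 u) (shifted_J x u) + sqsum (shifted_J x u)"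
      using ell2_lincomb(2)[OF A(2,1), of 1 "-1"] ell2_lincomb(2)[OF u u, of x 0] by simp
    moreover have "0 \<le> sqsum (shifted_J 0 u) + 2 * ell2_inner (shifted_J 0 u) (shifted_J x u) + sqsum (shifted_J x u)"
      using ell2_lincomb(2)[OF A(2,1), of 1 1] sqsum_nonneg[OF ell2_lincomb(1)[OF A(2,1), of 1 1]] by simp
    moreover have "sqsum (shifted_J 0 u) \<le> 9 * sqsum u" using shifted_J_bound(2)[OF u, of 0] by simp
    moreover have "25 * sqsum u \<le> x\<^sup>2 * sqsum u" using x sqsum_nonneg[OF u] by (intro mult_right_mono) auto
    ultimately show ?thesis using sqsum_nonneg[OF u] by linarith
  qed
  then have "bij_betw (shifted_J x) ell2 ell2" by (intro bij_shifted_J_of_bounded_below[of 1]) auto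
  with assms show False by (simp add: spectrum_iff)
qed

end

subsection \<open>Solutions along Fibonacci blocks\<close>

lemma norm_vec2_sq: "(norm (v :: real^2))\<^sup>2 = (v$1)\<^sup>2 + (v$2)\<^sup>2"
  by (simp add: norm_vec_def L2_set_def sum_2)

lemma norm_vec2_le: "norm (v :: real^2) \<le> \<bar>v$1\<bar> + \<bar>v$2\<bar>"
  using norm_le_l1_cart[of v] by (simp add: sum_2)

text \<open>The constant is 6 + 1 + 1, the sum of the bounds for the nontrivial entries; the inverse
  matrix has entries of the same size.\<close>

lemma norm_transfer_matrix_le:
  assumes "\<bar>x\<bar> \<le> 5" "\<bar>c\<bar> \<le> 1"
  shows "norm (transfer_matrix x c *v v) \<le> 8 * norm v" "norm v \<le> 8 * norm (transfer_matrix x c *v v)"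
proof -
  have comp: "(transfer_matrix x c *v v)$1 = (x - c) * v$1 - v$2" "(transfer_matrix x c *v v)$2 = v$1"
    by (simp_all add: transfer_matrix_def matrix_vector_mult_def sum_2)
  have 6: "\<bar>(x - c) * y\<bar> \<le> 6 * \<bar>y\<bar>" for y
    unfolding abs_mult using assms by (intro mult_right_mono) auto
  show "norm (transfer_matrix x c *v v) \<le> 8 * norm v"
    using norm_vec2_le[of "transfer_matrix x c *v v"] 6[of "v$1"] component_le_norm_cart[of v 1] component_le_norm_cart[of v 2]
    unfolding comp by linarith
  show "norm v \<le> 8 * norm (transfer_matrix x c *v v)"
    using norm_vec2_le[of v] 6[of "v$1"] component_le_norm_cart[of "transfer_matrix x c *v v" 1] component_le_norm_cart[of "transfer_matrix x c *v v" 2]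
    unfolding comp by linarith
qed

lemma norm_transfer_prod_fib_letter_le:
  assumes "\<bar>x\<bar> \<le> 5"
  shows "norm (transfer_prod (fib_letter \<theta>) x n l *v v) \<le> 8 ^ l * norm v"
proof (induction l)
  case (Suc l)
  have "norm (transfer_prod (fib_letter \<theta>) x n (Suc l) *v v) \<le> 8 * norm (transfer_prod (fib_letter \<theta>) x n l *v v)"
    using norm_transfer_matrix_le(1)[OF assms, of "fib_letter \<theta> (n + int l)"] fib_letter_01[of \<theta> "n + int l"]
    by (auto simp flip: matrix_vector_mul_assoc)
  then show ?case using Suc by simp
qed simp

text \<open>At index 0 the second component is 0: this is the boundary condition that fixes a
  solution up to the factor \<open>u 0\<close>.\<close>

definition vpair :: "(nat \<Rightarrow> real) \<Rightarrow> nat \<Rightarrow> real^2" where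
  "vpair u n = vector [u n, shift_down u n]"

lemma norm_vpair_sq: "(norm (vpair u n))\<^sup>2 = (u n)\<^sup>2 + (shift_down u n)\<^sup>2"
  by (simp add: norm_vec2_sq vpair_def)

lemma bounded_potential_fib_pot: "bounded_potential (fib_pot \<theta>)"
proof
  show "\<bar>fib_pot \<theta> n\<bar> \<le> 1" for n
    using fib_letter_01[of \<theta> "int n"] by (auto simp: fib_pot_eq_fib_letter)
qed

locale fib_jacobi =
  fixes \<theta> :: real and x :: real
  assumes x_le: "\<bar>x\<bar> \<le> 5"
begin

sublocale bounded_potential "fib_pot \<theta>"
  by (rule bounded_potential_fib_pot)

text \<open>Storage index \<open>n\<close> stands for site \<open>n + 1\<close>, so the step from
  \<open>n\<close> reads the letter at \<open>n + 1\<close>. This is the origin of the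
  \<open>+ 1\<close> in all later windows.\<close>

lemma vpair_Suc: "vpair u (Suc n) = transfer_matrix x (fib_letter \<theta> (int (Suc n))) *v vpair u n + vector [shifted_J x u n, 0]"
  unfolding vec_eq_iff forall_2
  by (simp add: vpair_def transfer_matrix_def matrix_vector_mult_def sum_2 shifted_J_eq fib_pot_eq_fib_letter algebra_simps)
     (simp add: shift_down_def)

text \<open>Stated for arbitrary \<open>u\<close> with the residual as error, because it serves both
  the exact solution \<open>p\<close> and the lower bound for the operator on all of
  \<open>ell2\<close>.\<close>

lemma vpair_propagate:
  "norm (vpair u (n + l) - transfer_prod (fib_letter \<theta>) x (int n + 1) l *v vpair u n) \<le> 8 ^ l * (\<Sum>k<l. \<bar>shifted_J x u (n + k)\<bar>)"
proof (induction l)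
  case (Suc l)
  define d where "d = vpair u (n + l) - transfer_prod (fib_letter \<theta>) x (int n + 1) l *v vpair u n"
  have "vpair u (n + Suc l) - transfer_prod (fib_letter \<theta>) x (int n + 1) (Suc l) *v vpair u n
      = transfer_matrix x (fib_letter \<theta> (int n + 1 + int l)) *v d + vector [shifted_J x u (n + l), 0]"
    using vpair_Suc[of u "n + l"]
    by (simp add: d_def matrix_vector_mult_diff_distrib add_ac flip: matrix_vector_mul_assoc)
  also have "norm \<dots> \<le> 8 * norm d + \<bar>shifted_J x u (n + l)\<bar>"
  proof (rule order_trans[OF norm_triangle_ineq add_mono])
    show "norm (transfer_matrix x (fib_letter \<theta> (int n + 1 + int l)) *v d) \<le> 8 * norm d"
      using fib_letter_01[of \<theta> "int n + 1 + int l"] by (intro norm_transfer_matrix_le x_le) auto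
    show "norm (vector [shifted_J x u (n + l), 0] :: real^2) \<le> \<bar>shifted_J x u (n + l)\<bar>"
      using norm_vec2_le[of "vector [shifted_J x u (n + l), 0]"] by simp
  qed
  also have "\<dots> \<le> 8 * (8 ^ l * (\<Sum>k<l. \<bar>shifted_J x u (n + k)\<bar>)) + 8 ^ Suc l * \<bar>shifted_J x u (n + l)\<bar>"
  proof (intro add_mono mult_left_mono)
    show "norm d \<le> 8 ^ l * (\<Sum>k<l. \<bar>shifted_J x u (n + k)\<bar>)" using Suc by (simp add: d_def)
    show "\<bar>shifted_J x u (n + l)\<bar> \<le> 8 ^ Suc l * \<bar>shifted_J x u (n + l)\<bar>"
      using mult_right_mono[of 1 "8 ^ Suc l" "\<bar>shifted_J x u (n + l)\<bar>"] one_le_power[of "8::real" "Suc l"] by simp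
  qed auto
  finally show ?case by (simp add: algebra_simps)
qed simp

text \<open>Depends on energy and scale, but always multiplies the residual, which vanishes for
  \<open>p\<close>.\<close>

definition square_err :: "nat \<Rightarrow> real" where
  "square_err i = (\<bar>fib_trace x i\<bar> + 8 ^ fib (Suc i) + 1) * 8 ^ fib (Suc i)"

lemma square_err_nonneg: "0 \<le> square_err i"
  by (simp add: square_err_def)

lemma square_relation:
  assumes i: "3 \<le> i" and n: "defect_free \<theta> i (int n + 1)" and q: "q = fib (Suc i)"
  shows "norm (vpair u (n + 2 * q) + vpair u n - fib_trace x i *\<^sub>R vpair u (n + q))
      \<le> square_err i * (\<Sum>k<2 * q. \<bar>shifted_J x u (n + k)\<bar>)"
proof -
  define M where "M = transfer_prod (fib_letter \<theta>) x (int n + 1) q"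
  have M': "transfer_prod (fib_letter \<theta>) x (int (n + q) + 1) q = M"
    using defect_free_square(1)[OF i n, of x] by (simp add: M_def q add_ac del: fib.simps)
  have t: "trace M = fib_trace x i" unfolding M_def q by (rule defect_free_square(2)[OF i n])
  have d: "det M = 1" by (simp add: M_def det_transfer_prod)
  define s where "s = (\<Sum>k<2 * q. \<bar>shifted_J x u (n + k)\<bar>)"
  have s1: "(\<Sum>k<q. \<bar>shifted_J x u (n + k)\<bar>) \<le> s" unfolding s_def by (rule sum_mono2) auto
  have "(\<Sum>k<q. \<bar>shifted_J x u (n + q + k)\<bar>) = (\<Sum>k\<in>(+) q ` {..<q}. \<bar>shifted_J x u (n + k)\<bar>)"
    by (subst sum.reindex) (auto simp: add.assoc)
  also have "\<dots> \<le> s" unfolding s_def by (rule sum_mono2) auto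
  finally have s2: "(\<Sum>k<q. \<bar>shifted_J x u (n + q + k)\<bar>) \<le> s" .
  define e1 e2 where "e1 = vpair u (n + q) - M *v vpair u n" and "e2 = vpair u (n + 2 * q) - M *v vpair u (n + q)"
  have e1: "norm e1 \<le> 8 ^ q * s"
    unfolding e1_def M_def by (rule order_trans[OF vpair_propagate mult_left_mono[OF s1]]) simp
  have e2: "norm e2 \<le> 8 ^ q * s"
    using order_trans[OF vpair_propagate[of u "n + q" q] mult_left_mono[OF s2]] unfolding e2_def M'
    by (simp add: add.assoc mult_2)
  have "M *v (M *v vpair u n) = fib_trace x i *\<^sub>R (M *v vpair u n) - vpair u n"
    using cayley_hamilton_2[OF d] t by simp
  moreover have "M *v vpair u n = vpair u (n + q) - e1" by (simp add: e1_def)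
  ultimately have "M *v vpair u (n + q) - M *v e1 = fib_trace x i *\<^sub>R vpair u (n + q) - fib_trace x i *\<^sub>R e1 - vpair u n"
    by (simp add: matrix_vector_mult_diff_distrib scaleR_diff_right)
  then have "vpair u (n + 2 * q) + vpair u n - fib_trace x i *\<^sub>R vpair u (n + q) = e2 + M *v e1 - fib_trace x i *\<^sub>R e1"
    unfolding e2_def by (simp add: algebra_simps)
  also have "norm \<dots> \<le> norm e2 + norm (M *v e1) + \<bar>fib_trace x i\<bar> * norm e1"
    by (metis (no_types) norm_triangle_ineq4 norm_triangle_ineq norm_scaleR order_trans add_right_mono)
  also have "\<dots> \<le> 8 ^ q * s + 8 ^ q * (8 ^ q * s) + \<bar>fib_trace x i\<bar> * (8 ^ q * s)"
  proof (intro add_mono mult_left_mono e1 e2)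
    have "norm (M *v e1) \<le> 8 ^ q * norm e1" unfolding M_def by (rule norm_transfer_prod_fib_letter_le[OF x_le])
    also have "\<dots> \<le> 8 ^ q * (8 ^ q * s)" by (intro mult_left_mono e1) auto
    finally show "norm (M *v e1) \<le> 8 ^ q * (8 ^ q * s)" .
  qed auto
  also have "\<dots> = square_err i * s" by (simp add: square_err_def q algebra_simps del: fib.simps)
  finally show ?thesis by (simp add: s_def)
qed

section \<open>Escaped energies: centres of squares with large traces\<close>

text \<open>How far to the left a centred square can reach: the longer of the two periods, plus one
  for moving the centre.\<close>

definition escape_len :: "nat \<Rightarrow> nat" where
  "escape_len j = Suc (fib (Suc (Suc j)))"

text \<open>Both ends of the square, for either of two periods and either of two centres; together
  at most eight positions.\<close>

definition escape_offs :: "nat \<Rightarrow> nat set" where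
  "escape_offs j = (\<Union>q\<in>{fib (Suc j), fib (Suc (Suc j))}.
     {escape_len j - q, Suc (escape_len j - q), escape_len j + q, Suc (escape_len j + q)})"

lemma escape_offs: "finite (escape_offs j)" "card (escape_offs j) \<le> 8" "a \<in> escape_offs j \<Longrightarrow> a \<le> 2 * escape_len j"
proof -
  show "finite (escape_offs j)" by (simp add: escape_offs_def)
  have c4: "card {a, b, c, d} \<le> 4" for a b c d :: nat
    using card_length[of "[a, b, c, d]"] by simp
  have "card (escape_offs j) \<le> (\<Sum>q\<in>{fib (Suc j), fib (Suc (Suc j))}. card {escape_len j - q, Suc (escape_len j - q), escape_len j + q, Suc (escape_len j + q)})"
    unfolding escape_offs_def by (rule card_UN_le) auto
  also have "\<dots> \<le> (\<Sum>q\<in>{fib (Suc j), fib (Suc (Suc j))}. 4)" by (intro sum_mono c4)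
  also have "\<dots> \<le> 8" using card_length[of "[fib (Suc j), fib (Suc (Suc j))]"] by simp
  finally show "card (escape_offs j) \<le> 8" .
  show "a \<in> escape_offs j \<Longrightarrow> a \<le> 2 * escape_len j"
    using fib_neq_0_nat[of "Suc j"] by (auto simp: escape_offs_def escape_len_def)
qed

text \<open>Cayley-Hamilton read at the middle: the trace times the central vector is the sum of the
  two outer ones up to the residual. Dividing by 128 and paying 8 for a possible shift of the centre
  gives 1/16.\<close>

lemma center_bound:
  assumes j: "3 \<le> j" and big: "\<bar>fib_trace x j\<bar> > 128" "\<bar>fib_trace x (Suc j)\<bar> > 128"
  shows "\<exists>a\<in>escape_offs j. \<exists>c\<in>escape_offs j. norm (vpair u (n + escape_len j)) \<le>
     1/16 * (norm (vpair u (n + a)) + norm (vpair u (n + c))) +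
     8 * (1 + square_err j + square_err (Suc j)) * (\<Sum>k\<le>2 * escape_len j. \<bar>shifted_J x u (n + k)\<bar>)"
proof -
  define s where "s = (\<Sum>k\<le>2 * escape_len j. \<bar>shifted_J x u (n + k)\<bar>)"
  have s0: "0 \<le> s" unfolding s_def by (rule sum_nonneg) auto
  define N where "N = n + escape_len j"
  obtain \<epsilon> i where \<epsilon>: "\<epsilon> \<in> {0, 1::nat}" and i: "i \<in> {j, Suc j}"
    and cl: "defect_free \<theta> i (int N + 1 + int \<epsilon> - int (fib (Suc i)))"
    using ex_defect_free_center[OF j, of "int N + 1" \<theta>]
    by (metis add.right_neutral insertE insertI1 insertI2 of_nat_0 of_nat_1 singletonD)
  define q where "q = fib (Suc i)"
  have q: "q < escape_len j" using i fib_neq_0_nat[of j] j by (auto simp: q_def escape_len_def)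
  define m where "m = N + \<epsilon> - q"
  have m: "int N + 1 + int \<epsilon> - int (fib (Suc i)) = int m + 1" "m + q = N + \<epsilon>" "n \<le> m" "m + 2 * q = N + \<epsilon> + q"
    using q by (auto simp: m_def q_def N_def simp del: fib.simps)
  have i3: "3 \<le> i" using i j by auto
  have sq: "norm (vpair u (N + \<epsilon> + q) + vpair u m - fib_trace x i *\<^sub>R vpair u (N + \<epsilon>))
      \<le> square_err i * (\<Sum>k<2 * q. \<bar>shifted_J x u (m + k)\<bar>)"
    using square_relation[OF i3 cl[unfolded m(1)] q_def, of u] m by simp
  have "(\<Sum>k<2 * q. \<bar>shifted_J x u (m + k)\<bar>) = (\<Sum>k\<in>(+) (m - n) ` {..<2 * q}. \<bar>shifted_J x u (n + k)\<bar>)"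
    using m(3) by (subst sum.reindex) (auto simp: add.assoc[symmetric])
  also have "\<dots> \<le> s"
    unfolding s_def using q \<epsilon> by (intro sum_mono2) (auto simp: m_def N_def)
  finally have "norm (vpair u (N + \<epsilon> + q) + vpair u m - fib_trace x i *\<^sub>R vpair u (N + \<epsilon>)) \<le> square_err i * s"
    using sq square_err_nonneg[of i] by (meson mult_left_mono order_trans)
  moreover have "\<bar>fib_trace x i\<bar> * norm (vpair u (N + \<epsilon>)) \<le> norm (vpair u (N + \<epsilon> + q) + vpair u m)
     + norm (vpair u (N + \<epsilon> + q) + vpair u m - fib_trace x i *\<^sub>R vpair u (N + \<epsilon>))"
    by (metis norm_scaleR norm_triangle_sub norm_minus_commute)
  moreover have "norm (vpair u (N + \<epsilon> + q) + vpair u m) \<le> norm (vpair u (N + \<epsilon> + q)) + norm (vpair u m)"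
    by (rule norm_triangle_ineq)
  moreover have "128 * norm (vpair u (N + \<epsilon>)) \<le> \<bar>fib_trace x i\<bar> * norm (vpair u (N + \<epsilon>))"
    using big i by (intro mult_right_mono) auto
  moreover have "square_err i * s \<le> (square_err j + square_err (Suc j)) * s"
    using i square_err_nonneg s0 by (intro mult_right_mono) auto
  ultimately have 1: "128 * norm (vpair u (N + \<epsilon>)) \<le>
      norm (vpair u (N + \<epsilon> + q)) + norm (vpair u m) + (square_err j + square_err (Suc j)) * s" by linarith
  \<comment> \<open>If the square is centred one site to the right, one step back costs the factor
    8.\<close>
  have 2: "norm (vpair u N) \<le> 8 * norm (vpair u (N + \<epsilon>)) + 8 * s"
  proof (cases "\<epsilon> = 0")
    case False
    then have e: "N + \<epsilon> = Suc N" using \<epsilon> by auto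
    have "norm (vpair u N) \<le> 8 * norm (transfer_matrix x (fib_letter \<theta> (int (Suc N))) *v vpair u N)"
      using fib_letter_01[of \<theta> "int (Suc N)"] by (intro norm_transfer_matrix_le x_le) auto
    also have "transfer_matrix x (fib_letter \<theta> (int (Suc N))) *v vpair u N = vpair u (Suc N) - vector [shifted_J x u N, 0]"
      by (simp add: vpair_Suc)
    also have "norm \<dots> \<le> norm (vpair u (Suc N)) + norm (vector [shifted_J x u N, 0] :: real^2)"
      by (rule norm_triangle_ineq4)
    also have "norm (vector [shifted_J x u N, 0] :: real^2) \<le> \<bar>shifted_J x u N\<bar>"
      using norm_vec2_le[of "vector [shifted_J x u N, 0]"] by simp
    also have "\<bar>shifted_J x u N\<bar> \<le> s"
      unfolding s_def N_def by (rule member_le_sum[of "escape_len j" "{..2 * escape_len j}" "\<lambda>k. \<bar>shifted_J x u (n + k)\<bar>"]) auto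
    finally show ?thesis by (simp add: e)
  qed (use s0 norm_ge_zero[of "vpair u N"] in simp)
  have "norm (vpair u N) \<le> 1/16 * (norm (vpair u m) + norm (vpair u (N + \<epsilon> + q)))
      + 8 * (1 + square_err j + square_err (Suc j)) * s"
  proof -
    have "0 \<le> (square_err j + square_err (Suc j)) * s" using square_err_nonneg s0 by simp
    then show ?thesis using 1 2 by (simp add: algebra_simps)
  qed
  moreover have "m - n \<in> escape_offs j" "N + \<epsilon> + q - n \<in> escape_offs j"
    using i \<epsilon> q by (auto simp: escape_offs_def q_def m_def N_def simp del: fib.simps)
  moreover have "n + (m - n) = m" "n + (N + \<epsilon> + q - n) = N + \<epsilon> + q" using m(3) by (auto simp: N_def)
  ultimately show ?thesis unfolding N_def[symmetric] s_def[symmetric] by metis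
qed

definition energy :: "(nat \<Rightarrow> real) \<Rightarrow> nat \<Rightarrow> real" where
  "energy u n = (norm (vpair u n))\<^sup>2"

lemma energy_nonneg: "0 \<le> energy u n"
  by (simp add: energy_def)

lemma energy_eq: "energy u n = (u n)\<^sup>2 + (shift_down u n)\<^sup>2"
  by (simp add: energy_def norm_vpair_sq)

lemma summable_energy: "u \<in> ell2 \<Longrightarrow> summable (energy u)"
  unfolding energy_eq[abs_def] using shift_down_ell2(1)[of u]
  by (intro summable_add) (simp_all add: ell2_def)

lemma sqsum_le_energy: "u \<in> ell2 \<Longrightarrow> sqsum u \<le> suminf (energy u)"
  unfolding sqsum_def
  by (intro suminf_le summable_energy) (auto simp: energy_eq ell2_def)

text \<open>Squaring \<open>center_bound\<close> and summing over all centres puts 8/32 of the total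
  energy on the right, where it is absorbed. What remains is the head, whose indices are too close
  to the boundary to be centres.\<close>

lemma energy_tail_bound:
  assumes j: "3 \<le> j" and big: "\<bar>fib_trace x j\<bar> > 128" "\<bar>fib_trace x (Suc j)\<bar> > 128"
  shows "\<exists>D\<ge>0. \<forall>u\<in>ell2. suminf (energy u) \<le> 2 * (\<Sum>n<escape_len j. energy u n) + D * sqsum (shifted_J x u)"
proof -
  define L where "L = escape_len j"
  define C where "C = 8 * (1 + square_err j + square_err (Suc j))"
  define D where "D = 2 * C\<^sup>2 * real (Suc (2 * L))"
  have D0: "0 \<le> D" by (simp add: D_def)
  have main: "suminf (energy u) \<le> 2 * (\<Sum>n<L. energy u n) + 2 * (D * real (Suc (2 * L))) * sqsum (shifted_J x u)"
    if u: "u \<in> ell2" for u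
  proof -
    define f where "f = shifted_J x u"
    have f: "f \<in> ell2" using u shifted_J_bound by (simp add: f_def)
    have su: "summable (energy u)" using u by (rule summable_energy)
    have sf: "summable (\<lambda>k. (f k)\<^sup>2)" using f by (simp add: ell2_def)
    have le: "energy u (n + L) \<le> 1/32 * (\<Sum>a\<in>escape_offs j. energy u (n + a)) + D * (\<Sum>k\<le>2 * L. (f (n + k))\<^sup>2)" for n
    proof -
      define s where "s = (\<Sum>k\<le>2 * L. \<bar>f (n + k)\<bar>)"
      obtain a c where ac: "a \<in> escape_offs j" "c \<in> escape_offs j"
        "norm (vpair u (n + L)) \<le> 1/16 * (norm (vpair u (n + a)) + norm (vpair u (n + c))) + C * s"
        using center_bound[OF assms, of u n] unfolding L_def C_def s_def f_def by blast
      define y z where "y = norm (vpair u (n + a))" and "z = norm (vpair u (n + c))"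
      have "energy u (n + L) \<le> (1/16 * (y + z) + C * s)\<^sup>2"
        unfolding energy_def y_def z_def using ac(3) by (intro power_mono) auto
      also have "\<dots> \<le> 2 * (1/16 * (y + z))\<^sup>2 + 2 * (C * s)\<^sup>2"
        using zero_le_power2[of "1/16 * (y + z) - C * s"] by (simp only: power2_diff power2_sum)
      also have "(1/16 * (y + z))\<^sup>2 \<le> 1/128 * (y\<^sup>2 + z\<^sup>2)"
        using zero_le_power2[of "y - z"] by (simp add: power2_eq_square algebra_simps)
      also have "y\<^sup>2 + z\<^sup>2 \<le> 2 * (\<Sum>a\<in>escape_offs j. energy u (n + a))"
      proof -
        have "y\<^sup>2 \<le> (\<Sum>a\<in>escape_offs j. energy u (n + a))" "z\<^sup>2 \<le> (\<Sum>a\<in>escape_offs j. energy u (n + a))"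
          unfolding y_def z_def energy_def
          using member_le_sum[of _ "escape_offs j" "\<lambda>a. (norm (vpair u (n + a)))\<^sup>2"] ac escape_offs(1) by auto
        then show ?thesis by simp
      qed
      also have "(C * s)\<^sup>2 \<le> C\<^sup>2 * (real (Suc (2 * L)) * (\<Sum>k\<le>2 * L. (f (n + k))\<^sup>2))"
      proof -
        have "s\<^sup>2 \<le> (\<Sum>k\<le>2 * L. \<bar>f (n + k)\<bar>\<^sup>2) * real (card {..2 * L})"
          unfolding s_def by (rule sum_squared_le_sum_of_squares)
        then show ?thesis unfolding power_mult_distrib
          by (intro mult_left_mono) (simp_all add: mult.commute)
      qed
      finally show ?thesis by (simp add: D_def algebra_simps)
    qed
    have s1: "summable (\<lambda>n. energy u (n + a))" "(\<Sum>n. energy u (n + a)) \<le> suminf (energy u)" for a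
      using summable_shift[OF su] energy_nonneg by auto
    have s2: "summable (\<lambda>n. (f (n + a))\<^sup>2)" "(\<Sum>n. (f (n + a))\<^sup>2) \<le> sqsum f" for a
      using summable_shift[OF sf] by (auto simp: sqsum_def)
    have T0: "0 \<le> suminf (energy u)" using su energy_nonneg by (intro suminf_nonneg) auto
    have "(\<Sum>n. energy u (n + L)) \<le>
        (\<Sum>n. 1/32 * (\<Sum>a\<in>escape_offs j. energy u (n + a)) + D * (\<Sum>k\<le>2 * L. (f (n + k))\<^sup>2))"
      by (intro suminf_le le s1 summable_add summable_mult summable_sum s2)
    also have "\<dots> = 1/32 * (\<Sum>a\<in>escape_offs j. \<Sum>n. energy u (n + a)) + D * (\<Sum>k\<le>2 * L. \<Sum>n. (f (n + k))\<^sup>2)"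
      by (intro sums_unique[symmetric] sums_add sums_mult sums_sum summable_sums s1 s2)
    also have "(\<Sum>a\<in>escape_offs j. \<Sum>n. energy u (n + a)) \<le> (\<Sum>a\<in>escape_offs j. suminf (energy u))"
      by (intro sum_mono s1)
    also have "\<dots> \<le> 8 * suminf (energy u)"
      using mult_right_mono[of "real (card (escape_offs j))" 8] escape_offs(2)[of j] T0 by simp
    also have "(\<Sum>k\<le>2 * L. \<Sum>n. (f (n + k))\<^sup>2) \<le> (\<Sum>k\<le>2 * L. sqsum f)"
      by (intro sum_mono s2)
    finally have "(\<Sum>n. energy u (n + L)) \<le> 1/4 * suminf (energy u) + D * real (Suc (2 * L)) * sqsum f"
      using D0 by (simp add: mult_left_mono mult.assoc)
    moreover have "suminf (energy u) = (\<Sum>n. energy u (n + L)) + (\<Sum>n<L. energy u n)"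
      by (rule suminf_split_initial_segment[OF su])
    moreover have "0 \<le> (\<Sum>n<L. energy u n)" by (intro sum_nonneg energy_nonneg)
    moreover have "0 \<le> D * real (Suc (2 * L)) * sqsum f" using D0 sqsum_nonneg[OF f] by simp
    ultimately show ?thesis unfolding f_def using T0 by linarith
  qed
  show ?thesis
    using main D0 by (intro exI[of _ "2 * (D * real (Suc (2 * L)))"]) (auto simp: L_def)
qed

section \<open>The orthonormal polynomials as the solution at energy x\<close>

definition p :: "nat \<Rightarrow> real" where
  "p n = opoly (\<lambda>_. 1) (fib_pot \<theta>) n x"

lemma shifted_J_p: "shifted_J x p = (\<lambda>_. 0)"
proof
  fix k
  show "shifted_J x p k = 0"
    by (cases k) (simp_all add: shifted_J_eq p_def shift_down_def algebra_simps)
qed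

lemma vpair_p: "vpair p (n + l) = transfer_prod (fib_letter \<theta>) x (int n + 1) l *v vpair p n"
  using vpair_propagate[of p n l] by (simp add: shifted_J_p)

lemma energy_p_0: "energy p 0 = 1"
  by (simp add: energy_eq p_def shift_down_def)

lemma energy_p_pos: "0 < energy p n"
proof -
  have "vpair p n \<noteq> 0"
  proof
    assume "vpair p n = 0"
    moreover have "vpair p n = transfer_prod (fib_letter \<theta>) x 1 n *v vpair p 0" using vpair_p[of 0 n] by simp
    moreover have "invertible (transfer_prod (fib_letter \<theta>) x 1 n)"
      by (simp add: invertible_det_nz det_transfer_prod)
    ultimately have "vpair p 0 = 0"
      by (metis inj_matrix_vector_mult injD matrix_vector_mult_0_right)
    then show False using energy_p_0 by (simp add: energy_def)
  qed
  then show ?thesis by (simp add: energy_def)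
qed

text \<open>By the boundary condition \<open>u\<close> starts as \<open>u 0\<close> times
  \<open>p\<close>, and only the residual drives the two apart.\<close>

lemma energy_perturb:
  "energy u n \<le> 2 * (u 0)\<^sup>2 * energy p n + 2 * (64 ^ n * real n * (\<Sum>k<n. (shifted_J x u k)\<^sup>2))"
  "(u 0)\<^sup>2 * energy p n \<le> 2 * energy u n + 2 * (64 ^ n * real n * (\<Sum>k<n. (shifted_J x u k)\<^sup>2))"
proof -
  have v0: "vpair u 0 = u 0 *\<^sub>R vpair p 0"
    unfolding vec_eq_iff forall_2 by (simp add: vpair_def p_def shift_down_def)
  define e where "e = vpair u n - u 0 *\<^sub>R vpair p n"
  have "transfer_prod (fib_letter \<theta>) x 1 n *v vpair u 0 = u 0 *\<^sub>R vpair p n"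
    using vpair_p[of 0 n] unfolding v0 by (simp add: matrix_vector_mult_scaleR)
  then have "norm e \<le> 8 ^ n * (\<Sum>k<n. \<bar>shifted_J x u k\<bar>)"
    using vpair_propagate[of u 0 n] by (simp add: e_def)
  then have "(norm e)\<^sup>2 \<le> (8 ^ n * (\<Sum>k<n. \<bar>shifted_J x u k\<bar>))\<^sup>2" by (intro power_mono) auto
  also have "\<dots> = 64 ^ n * (\<Sum>k<n. \<bar>shifted_J x u k\<bar>)\<^sup>2"
    by (simp add: power_mult_distrib power2_eq_square flip: power_mult_distrib)
  also have "(\<Sum>k<n. \<bar>shifted_J x u k\<bar>)\<^sup>2 \<le> (\<Sum>k<n. \<bar>shifted_J x u k\<bar>\<^sup>2) * real (card {..<n})"
    by (rule sum_squared_le_sum_of_squares)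
  finally have e: "(norm e)\<^sup>2 \<le> 64 ^ n * real n * (\<Sum>k<n. (shifted_J x u k)\<^sup>2)" by (simp add: mult_ac)
  have tri: "(norm (y + z))\<^sup>2 \<le> 2 * (norm y)\<^sup>2 + 2 * (norm z)\<^sup>2" for y z :: "real^2"
  proof -
    have "(norm (y + z))\<^sup>2 \<le> (norm y + norm z)\<^sup>2" by (intro power_mono norm_triangle_ineq) auto
    also have "\<dots> \<le> 2 * (norm y)\<^sup>2 + 2 * (norm z)\<^sup>2"
      using zero_le_power2[of "norm y - norm z"] by (simp only: power2_diff power2_sum)
    finally show ?thesis .
  qed
  have u0: "(norm (u 0 *\<^sub>R vpair p n))\<^sup>2 = (u 0)\<^sup>2 * energy p n" by (simp add: energy_def power_mult_distrib)
  show "energy u n \<le> 2 * (u 0)\<^sup>2 * energy p n + 2 * (64 ^ n * real n * (\<Sum>k<n. (shifted_J x u k)\<^sup>2))"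
    using tri[of "u 0 *\<^sub>R vpair p n" e] e unfolding u0 by (simp add: e_def energy_def)
  show "(u 0)\<^sup>2 * energy p n \<le> 2 * energy u n + 2 * (64 ^ n * real n * (\<Sum>k<n. (shifted_J x u k)\<^sup>2))"
    using tri[of "vpair u n" "- e"] e norm_minus_commute[of "vpair u n" "u 0 *\<^sub>R vpair p n"]
    unfolding u0[symmetric] by (simp add: e_def energy_def)
qed

text \<open>Tail control leaves \<open>u 0\<close> as the only quantity not yet bounded by the
  residual. If \<open>p\<close> had infinite energy, a long enough initial segment would bound
  \<open>u 0\<close> as well, and the operator would be bounded below.\<close>

lemma escaped_spectrum_imp_ell2:
  assumes j: "3 \<le> j" and big: "\<bar>fib_trace x j\<bar> > 128" "\<bar>fib_trace x (Suc j)\<bar> > 128"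
    and spec: "x \<in> jacobi_spectrum (\<lambda>_. 1) (fib_pot \<theta>)"
  shows "p \<in> ell2"
proof (rule ccontr)
  assume notin: "p \<notin> ell2"
  define L where "L = escape_len j"
  obtain D where D: "D \<ge> 0"
    "\<And>u. u \<in> ell2 \<Longrightarrow> suminf (energy u) \<le> 2 * (\<Sum>n<L. energy u n) + D * sqsum (shifted_J x u)"
    using energy_tail_bound[OF j big] by (auto simp: L_def)
  define c where "c n = 64 ^ n * real n" for n
  have c0: "0 \<le> c n" for n by (simp add: c_def)
  define PL where "PL = (\<Sum>n<L. energy p n)"
  \<comment> \<open>The 8 is a factor 2 from each use of \<open>energy_perturb\<close> and one from
    the tail bound; the excess 2 remains as the coefficient of the square of
    \<open>u 0\<close>.\<close>
  obtain N where N: "(\<Sum>n<N. energy p n) > 8 * PL + 2"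
  proof (rule ccontr)
    assume "\<not> thesis"
    then have "(\<Sum>n<N. energy p n) \<le> 8 * PL + 2" for N using that not_le by blast
    then have "summable (energy p)" by (intro summableI_nonneg_bounded energy_nonneg) auto
    then have "summable (\<lambda>n. (p n)\<^sup>2)"
      by (rule summable_comparison_nonneg) (auto simp: energy_eq)
    with notin show False by (simp add: ell2_def)
  qed
  define cN cL where "cN = (\<Sum>n<N. c n)" and "cL = (\<Sum>n<L. c n)"
  have cN0: "0 \<le> cN" "0 \<le> cL" "0 \<le> PL"
    unfolding cN_def cL_def PL_def by (auto intro!: sum_nonneg c0 energy_nonneg)
  define H where "H = 2 * cN + 8 * cL + 2 * D"
  define R where "R = 4 * H * PL + 4 * cL + D"
  have R0: "0 \<le> R" using cN0 D(1) by (simp add: R_def H_def)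
  have main: "sqsum u \<le> R * sqsum (shifted_J x u)" if u: "u \<in> ell2" for u
  proof -
    define S where "S = sqsum (shifted_J x u)"
    have Au: "shifted_J x u \<in> ell2" using u shifted_J_bound by simp
    have S0: "0 \<le> S" unfolding S_def using Au by (rule sqsum_nonneg)
    have pS: "64 ^ n * real n * (\<Sum>k<n. (shifted_J x u k)\<^sup>2) \<le> c n * S" for n
      unfolding c_def S_def using sum_le_sqsum[OF Au, of "{..<n}"] by (intro mult_left_mono) auto
    have 1: "(\<Sum>n<L. energy u n) \<le> 2 * (u 0)\<^sup>2 * PL + 2 * (cL * S)"
    proof -
      have "(\<Sum>n<L. energy u n) \<le> (\<Sum>n<L. 2 * (u 0)\<^sup>2 * energy p n + 2 * (c n * S))"
        using energy_perturb(1)[of u] pS by (intro sum_mono) (smt (verit))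
      also have "\<dots> = 2 * (u 0)\<^sup>2 * PL + 2 * (cL * S)"
        by (simp add: sum.distrib PL_def cL_def sum_distrib_left sum_distrib_right)
      finally show ?thesis .
    qed
    have 2: "(u 0)\<^sup>2 * (\<Sum>n<N. energy p n) \<le> 2 * (\<Sum>n<N. energy u n) + 2 * (cN * S)"
    proof -
      have "(u 0)\<^sup>2 * (\<Sum>n<N. energy p n) \<le> (\<Sum>n<N. 2 * energy u n + 2 * (c n * S))"
        unfolding sum_distrib_left
        using energy_perturb(2)[of u] pS by (intro sum_mono) (smt (verit))
      also have "\<dots> = 2 * (\<Sum>n<N. energy u n) + 2 * (cN * S)"
        by (simp add: sum.distrib cN_def sum_distrib_left sum_distrib_right)
      finally show ?thesis .
    qed
    have 3: "(\<Sum>n<N. energy u n) \<le> suminf (energy u)"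
      by (intro sum_le_suminf summable_energy u) (auto simp: energy_nonneg)
    have 4: "suminf (energy u) \<le> 2 * (\<Sum>n<L. energy u n) + D * S"
      unfolding S_def by (rule D(2)[OF u])
    have 5: "(u 0)\<^sup>2 * (8 * PL + 2) \<le> (u 0)\<^sup>2 * (\<Sum>n<N. energy p n)"
      using N by (intro mult_left_mono) auto
    have u0: "(u 0)\<^sup>2 \<le> H * S"
    proof -
      have "(u 0)\<^sup>2 * (8 * PL + 2) = 8 * ((u 0)\<^sup>2 * PL) + 2 * (u 0)\<^sup>2"
        "H * S = 2 * (cN * S) + 8 * (cL * S) + 2 * (D * S)" "2 * (u 0)\<^sup>2 * PL = 2 * ((u 0)\<^sup>2 * PL)"
        by (simp_all add: H_def algebra_simps)
      then show ?thesis using 1 2 3 4 5 zero_le_power2[of "u 0"] by linarith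
    qed
    have "sqsum u \<le> 2 * (\<Sum>n<L. energy u n) + D * S"
      using sqsum_le_energy[OF u] 4 by linarith
    also have "\<dots> \<le> 2 * (2 * (u 0)\<^sup>2 * PL + 2 * (cL * S)) + D * S"
      using 1 by (intro add_right_mono mult_left_mono) auto
    also have "\<dots> \<le> 2 * (2 * (H * S) * PL + 2 * (cL * S)) + D * S"
      using u0 cN0 by (intro add_right_mono mult_left_mono mult_right_mono) auto
    also have "\<dots> = R * S" by (simp add: R_def algebra_simps)
    finally show ?thesis by (simp add: S_def)
  qed
  have "bij_betw (shifted_J x) ell2 ell2"
  proof (rule bij_shifted_J_of_bounded_below)
    show "1 / (R + 1) > 0" using R0 by simp
    show "1 / (R + 1) * sqsum u \<le> sqsum (shifted_J x u)" if u: "u \<in> ell2" for u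
    proof -
      have "0 \<le> sqsum (shifted_J x u)" using u shifted_J_bound by (intro sqsum_nonneg) auto
      then have "sqsum u \<le> (R + 1) * sqsum (shifted_J x u)" using main[OF u] by (simp add: algebra_simps)
      then show ?thesis using R0 by (simp add: field_simps)
    qed
  qed
  with spec show False by (simp add: spectrum_iff)
qed

text \<open>Otherwise, as \<open>p\<close> decays, its maximum from \<open>N - escape_len j\<close>
  on is attained at some \<open>m\<close> not before \<open>N\<close>. Centring a square near
  \<open>m\<close> bounds this maximum by an eighth of itself.\<close>

lemma escaped_ell2_window:
  assumes j: "3 \<le> j" and big: "\<bar>fib_trace x j\<bar> > 128" "\<bar>fib_trace x (Suc j)\<bar> > 128"
    and p: "p \<in> ell2" and N: "escape_len j \<le> N"
  shows "\<exists>m. N - escape_len j \<le> m \<and> m < N \<and> norm (vpair p N) \<le> norm (vpair p m)"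
proof (rule ccontr)
  define L where "L = escape_len j"
  assume "\<not> ?thesis"
  then have lt: "norm (vpair p m) < norm (vpair p N)" if "N - L \<le> m" "m < N" for m
    using that by (auto simp: not_le L_def)
  have pos: "0 < norm (vpair p N)" using energy_p_pos[of N] by (simp add: energy_def)
  have "energy p \<longlonglongrightarrow> 0" using summable_energy[OF p] by (rule summable_LIMSEQ_zero)
  then have "eventually (\<lambda>n. energy p n < energy p N) sequentially"
    using energy_p_pos[of N] by (intro order_tendstoD) auto
  then obtain K where K: "\<And>n. n \<ge> K \<Longrightarrow> energy p n < energy p N"
    by (auto simp: eventually_sequentially)
  have K': "norm (vpair p n) < norm (vpair p N)" if "n \<ge> K" for n
    using K[OF that] by (simp add: energy_def power_less_imp_less_base)
  have "N < K" using K[of N] by (meson less_irrefl not_le)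
  define S where "S = (\<lambda>n. norm (vpair p n)) ` {N..K}"
  have S: "finite S" "S \<noteq> {}" using \<open>N < K\<close> by (auto simp: S_def)
  obtain m where m: "N \<le> m" "norm (vpair p m) = Max S"
    using Max_in[OF S] by (auto simp: S_def)
  have le: "norm (vpair p n) \<le> norm (vpair p m)" if "N - L \<le> n" for n
  proof -
    have N': "norm (vpair p N) \<le> norm (vpair p m)"
      unfolding m(2) using S \<open>N < K\<close> by (intro Max_ge) (auto simp: S_def)
    consider "n < N" | "N \<le> n" "n \<le> K" | "K \<le> n" by linarith
    then show ?thesis
    proof cases
      case 1
      then show ?thesis using lt[OF that] N' by simp
    next
      case 2
      then show ?thesis unfolding m(2) using S by (intro Max_ge) (auto simp: S_def)
    next
      case 3
      then show ?thesis using K'[of n] N' by simp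
    qed
  qed
  have mL: "m - L + L = m" using m(1) N by (simp add: L_def)
  obtain a c where ac: "N - L \<le> a" "N - L \<le> c" "norm (vpair p m) \<le> 1/16 * (norm (vpair p a) + norm (vpair p c))"
  proof -
    obtain a c where "norm (vpair p m) \<le> 1/16 * (norm (vpair p (m - L + a)) + norm (vpair p (m - L + c)))"
      using center_bound[OF j big, of p "m - L"] mL by (auto simp: shifted_J_p L_def)
    then show thesis using m(1) by (intro that[of "m - L + a" "m - L + c"]) auto
  qed
  have "norm (vpair p a) \<le> norm (vpair p m)" "norm (vpair p c) \<le> norm (vpair p m)"
    using ac by (auto intro!: le)
  moreover have "0 < norm (vpair p m)" using energy_p_pos[of m] by (simp add: energy_def)
  ultimately show False using ac(3) by argo
qed

text \<open>The leftmost admissible position cannot be closer than \<open>escape_len j\<close> to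
  \<open>N\<close>, since the window lemma would move it further left.\<close>

lemma escaped_ell2_far:
  assumes j: "3 \<le> j" and big: "\<bar>fib_trace x j\<bar> > 128" "\<bar>fib_trace x (Suc j)\<bar> > 128"
    and p: "p \<in> ell2" and N: "2 * escape_len j \<le> N"
  shows "\<exists>m. N - 2 * escape_len j \<le> m \<and> m + escape_len j \<le> N \<and> norm (vpair p N) \<le> norm (vpair p m)"
proof -
  define P where "P m \<longleftrightarrow> N - 2 * escape_len j \<le> m \<and> m \<le> N \<and> norm (vpair p N) \<le> norm (vpair p m)" for m
  have "P N" by (simp add: P_def)
  define m where "m = (LEAST m. P m)"
  have m: "P m" unfolding m_def using \<open>P N\<close> by (rule LeastI)
  have "m + escape_len j \<le> N"
  proof (rule ccontr)
    assume *: "\<not> ?thesis"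
    then obtain m' where m': "m - escape_len j \<le> m'" "m' < m" "norm (vpair p m) \<le> norm (vpair p m')"
      using escaped_ell2_window[OF j big p, of m] N by auto
    then have "P m'" using m * by (auto simp: P_def)
    then have "m \<le> m'" unfolding m_def by (rule Least_le)
    then show False using m' by simp
  qed
  then show ?thesis using m by (auto simp: P_def)
qed

section \<open>Comparison at every scale, and the ratio bound\<close>

lemma bounded_far:
  assumes j: "3 \<le> j" and bd: "\<And>i. j \<le> i \<Longrightarrow> i \<le> j + 3 \<Longrightarrow> \<bar>fib_trace x i\<bar> \<le> 128"
    and N: "2 * fib (j + 4) \<le> N"
  shows "\<exists>m. N - 2 * fib (j + 4) \<le> m \<and> m + fib (Suc j) \<le> N \<and> norm (vpair p N) \<le> 130 * norm (vpair p m)"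
proof -
  obtain i where i: "j \<le> i" "i \<le> j + 3" "defect_free \<theta> i (int N + 1 - 2 * int (fib (Suc i)))"
    using ex_defect_free_left[of j \<theta> "int N + 1"] j by auto
  define q where "q = fib (Suc i)"
  have q: "fib (Suc j) \<le> q" "q \<le> fib (j + 4)" unfolding q_def using i by (auto intro!: fib_mono)
  define n where "n = N - 2 * q"
  have n: "int N + 1 - 2 * int (fib (Suc i)) = int n + 1" "n + 2 * q = N"
    using N q by (auto simp: n_def q_def simp del: fib.simps)
  have "norm (vpair p (n + 2 * q) + vpair p n - fib_trace x i *\<^sub>R vpair p (n + q)) \<le> 0"
    using square_relation[of i n q p] i j n by (simp add: shifted_J_p q_def del: fib.simps)
  then have "vpair p N = fib_trace x i *\<^sub>R vpair p (n + q) - vpair p n"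
    using n(2) by (simp add: algebra_simps)
  then have "norm (vpair p N) \<le> \<bar>fib_trace x i\<bar> * norm (vpair p (n + q)) + norm (vpair p n)"
    by (metis norm_scaleR norm_triangle_ineq4)
  also have "\<dots> \<le> 128 * norm (vpair p (n + q)) + norm (vpair p n)"
    using bd[of i] i by (intro add_right_mono mult_right_mono) auto
  finally consider "norm (vpair p N) \<le> 130 * norm (vpair p (n + q))" | "norm (vpair p N) \<le> 130 * norm (vpair p n)"
    using norm_ge_zero[of "vpair p n"] norm_ge_zero[of "vpair p (n + q)"] by linarith
  then show ?thesis
  proof cases
    case 1
    then show ?thesis using q n by (intro exI[of _ "n + q"]) auto
  next
    case 2
    then show ?thesis using q n by (intro exI[of _ "n"]) auto
  qed
qed

lemma spectrum_far:
  assumes spec: "x \<in> jacobi_spectrum (\<lambda>_. 1) (fib_pot \<theta>)" and j: "3 \<le> j" and N: "4 * fib (j + 7) \<le> N"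
  shows "\<exists>m. N - 4 * fib (j + 7) \<le> m \<and> m + fib (Suc j) \<le> N \<and> norm (vpair p N) \<le> 130 * norm (vpair p m)"
proof (cases "\<forall>i. j \<le> i \<and> i \<le> j + 3 \<longrightarrow> \<bar>fib_trace x i\<bar> \<le> 128")
  case True
  have le: "fib (j + 4) \<le> fib (j + 7)" by (intro fib_mono) simp
  obtain m where "N - 2 * fib (j + 4) \<le> m" "m + fib (Suc j) \<le> N" "norm (vpair p N) \<le> 130 * norm (vpair p m)"
    using bounded_far[OF j, of N] True N le by auto
  then show ?thesis using le by (intro exI[of _ m]) (auto simp del: fib.simps)
next
  case False
  then obtain i where i: "i \<le> j + 3" "\<bar>fib_trace x i\<bar> > 128" by force
  \<comment> \<open>The escape lemma needs two further scales after \<open>i\<close>, which is at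
    most \<open>j + 3\<close>; hence \<open>j + 5\<close> and its successor.\<close>
  have big: "\<bar>fib_trace x (j + 5)\<bar> > 128" "\<bar>fib_trace x (Suc (j + 5))\<bar> > 128"
    using fib_trace_escape[of 128 x i] x_le i by auto
  have "p \<in> ell2" using escaped_spectrum_imp_ell2[of "j + 5"] big j spec by auto
  define L where "L = escape_len (j + 5)"
  have "L = Suc (fib (j + 7))" by (simp add: L_def escape_len_def numeral_eq_Suc)
  moreover have "fib (j + 7) > 0" "fib (Suc j) \<le> fib (j + 7)"
    using fib_neq_0_nat[of "j + 7"] by (auto intro!: fib_mono)
  ultimately have L: "2 * L \<le> 4 * fib (j + 7)" "fib (Suc j) \<le> L" by simp_all
  obtain m where m: "N - 2 * L \<le> m" "m + L \<le> N" "norm (vpair p N) \<le> norm (vpair p m)"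
    using escaped_ell2_far[of "j + 5" N] big j \<open>p \<in> ell2\<close> L N by (auto simp: L_def)
  have "norm (vpair p N) \<le> 130 * norm (vpair p m)"
    using m(3) norm_ge_zero[of "vpair p m"] by linarith
  then show ?thesis using m(1,2) L by (intro exI[of _ m]) auto
qed

text \<open>Scales are taken ten apart so that their distance ranges are disjoint and the
  \<open>S\<close> positions distinct. The constant is twice the square of 130, as each square of
  \<open>p\<close> enters at most two energies.\<close>

lemma spectrum_ratio_bound:
  assumes spec: "x \<in> jacobi_spectrum (\<lambda>_. 1) (fib_pot \<theta>)" and N: "4 * fib (10 * S + 10) \<le> N" and S: "0 < S"
  shows "(p N)\<^sup>2 / CD_kernel (\<lambda>_. 1) (fib_pot \<theta>) N x x \<le> 33800 / real S"
proof -
  have fm: "4 * fib (10 * s + 10) \<le> N" if "s < S" for s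
  proof -
    have "fib (10 * s + 10) \<le> fib (10 * S + 10)" using that by (intro fib_mono) simp
    then show ?thesis using N by linarith
  qed
  have "\<exists>m. N \<le> m + 4 * fib (10 * s + 10) \<and> m + fib (10 * s + 4) \<le> N \<and> norm (vpair p N) \<le> 130 * norm (vpair p m)"
    if "s < S" for s
  proof -
    have eq: "(10 * s + 3) + 7 = 10 * s + 10" "Suc (10 * s + 3) = 10 * s + 4" by simp_all
    from spectrum_far[OF spec, of "10 * s + 3" N] fm[OF that] show ?thesis
      unfolding eq by (auto simp: le_diff_conv)
  qed
  then obtain m where m: "\<And>s. s < S \<Longrightarrow> N \<le> m s + 4 * fib (10 * s + 10)"
      "\<And>s. s < S \<Longrightarrow> m s + fib (10 * s + 4) \<le> N"
      "\<And>s. s < S \<Longrightarrow> norm (vpair p N) \<le> 130 * norm (vpair p (m s))"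
    by metis
  have less: "m s' < m s" if "s < s'" "s' < S" for s s'
  proof -
    have "4 * fib (10 * s + 10) < fib (10 * s + 10 + 4)" by (rule four_fib_less) simp
    also have "\<dots> \<le> fib (10 * s' + 4)" using that by (intro fib_mono) simp
    finally show ?thesis using m(1)[of s] m(2)[of s'] that by linarith
  qed
  have inj: "inj_on m {..<S}"
  proof (rule inj_onI)
    fix s s' assume "s \<in> {..<S}" "s' \<in> {..<S}" "m s = m s'"
    then show "s = s'" using less[of s s'] less[of s' s] by (metis lessThan_iff less_irrefl linorder_neqE_nat)
  qed
  define K where "K = (\<Sum>n\<le>N. (p n)\<^sup>2)"
  have Keq: "CD_kernel (\<lambda>_. 1) (fib_pot \<theta>) N x x = K"
    by (simp add: CD_kernel_def K_def p_def power2_eq_square)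
  have "real S * energy p N = (\<Sum>s<S. energy p N)" by simp
  also have "\<dots> \<le> (\<Sum>s<S. 16900 * energy p (m s))"
  proof (rule sum_mono)
    fix s assume "s \<in> {..<S}"
    then have "(norm (vpair p N))\<^sup>2 \<le> (130 * norm (vpair p (m s)))\<^sup>2"
      using m(3)[of s] by (intro power_mono) auto
    then show "energy p N \<le> 16900 * energy p (m s)" by (simp add: energy_def power_mult_distrib)
  qed
  also have "\<dots> = 16900 * (\<Sum>n\<in>m ` {..<S}. energy p n)"
    using inj by (simp add: sum.reindex sum_distrib_left)
  also have "(\<Sum>n\<in>m ` {..<S}. energy p n) \<le> (\<Sum>n\<le>N. energy p n)"
  proof (rule sum_mono2)
    show "m ` {..<S} \<subseteq> {..N}"
    proof (rule image_subsetI)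
      fix s assume "s \<in> {..<S}"
      then show "m s \<in> {..N}" using m(2)[of s] by simp
    qed
  qed (auto simp: energy_nonneg)
  also have "\<dots> \<le> 2 * K"
  proof -
    have "(\<Sum>n\<le>N. (shift_down p n)\<^sup>2) \<le> K"
    proof -
      have "(\<Sum>n\<le>N. (shift_down p n)\<^sup>2) = (\<Sum>n<N. (p n)\<^sup>2)"
        by (subst sum.atMost_shift) (simp add: shift_down_def)
      also have "\<dots> \<le> K" unfolding K_def by (rule sum_mono2) auto
      finally show ?thesis .
    qed
    then show ?thesis by (simp add: energy_eq sum.distrib K_def)
  qed
  finally have "real S * energy p N \<le> 33800 * K" by simp
  moreover have "(p N)\<^sup>2 \<le> energy p N" by (simp add: energy_eq)
  ultimately have "real S * (p N)\<^sup>2 \<le> 33800 * K"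
    using mult_left_mono[of "(p N)\<^sup>2" "energy p N" "real S"] by simp
  moreover have "0 < K"
  proof -
    have "(p 0)\<^sup>2 \<le> K" unfolding K_def by (rule member_le_sum) auto
    then show ?thesis by (simp add: p_def)
  qed
  ultimately show ?thesis unfolding Keq using S by (simp add: field_simps)
qed

text \<open>Needed because the supremum over an empty spectrum would be an unspecified real. A preimage of $\delta_0$
  would be a decaying solution, which squares to the right of site $1$ exclude.\<close>
lemma bounded_trace_in_spectrum:
  assumes bd: "\<And>i. \<bar>fib_trace x i\<bar> \<le> 128"
  shows "x \<in> jacobi_spectrum (\<lambda>_. 1) (fib_pot \<theta>)"
proof (rule ccontr)
  assume "\<not> ?thesis"
  then have bij: "bij_betw (shifted_J x) ell2 ell2" by (simp add: spectrum_iff)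
  define \<delta> :: "nat \<Rightarrow> real" where "\<delta> n = (if n = 0 then 1 else 0)" for n
  have "\<delta> \<in> ell2" unfolding ell2_def mem_Collect_eq
    by (rule summable_finite[of "{0}"]) (auto simp: \<delta>_def)
  then obtain u where u: "u \<in> ell2" "shifted_J x u = \<delta>"
    using bij by (metis bij_betw_imp_surj_on imageE)
  have "energy u \<longlonglongrightarrow> 0" using summable_energy[OF u(1)] by (rule summable_LIMSEQ_zero)
  then have "(\<lambda>n. sqrt (energy u n)) \<longlonglongrightarrow> sqrt 0" by (intro tendsto_real_sqrt)
  then have lim: "(\<lambda>n. norm (vpair u n)) \<longlonglongrightarrow> 0" by (simp add: energy_def)
  have "norm (vpair u 1) \<le> e" if "e > 0" for e
  proof -
    have "eventually (\<lambda>n. norm (vpair u n) < e / 129) sequentially"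
      using lim that by (intro order_tendstoD) auto
    then obtain M where M: "\<And>n. n \<ge> M \<Longrightarrow> norm (vpair u n) < e / 129"
      by (auto simp: eventually_sequentially)
    \<comment> \<open>The square starts to the right of index 0, the only place where the residual
      is nonzero, so its relation is exact.\<close>
    obtain i where i: "M + 3 \<le> i" "defect_free \<theta> i (int 1 + 1)"
      using ex_defect_free_right[of "M + 3" \<theta> "int 1 + 1"] by auto
    define q where "q = fib (Suc i)"
    have q: "M \<le> q" using i fib_Suc_ge[of i] by (simp add: q_def del: fib.simps)
    have "norm (vpair u (1 + 2 * q) + vpair u 1 - fib_trace x i *\<^sub>R vpair u (1 + q)) \<le> 0"
      using square_relation[of i 1 q u] i by (simp add: u(2) \<delta>_def q_def del: fib.simps)
    then have "vpair u 1 = fib_trace x i *\<^sub>R vpair u (1 + q) - vpair u (1 + 2 * q)"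
      by (simp add: algebra_simps)
    then have "norm (vpair u 1) \<le> \<bar>fib_trace x i\<bar> * norm (vpair u (1 + q)) + norm (vpair u (1 + 2 * q))"
      by (metis norm_scaleR norm_triangle_ineq4)
    also have "\<dots> \<le> 128 * (e / 129) + e / 129"
      using bd[of i] M[of "1 + q"] M[of "1 + 2 * q"] q by (intro add_mono mult_mono) auto
    finally show ?thesis by simp
  qed
  then have "norm (vpair u 1) \<le> 0" by (metis field_le_epsilon add_0)
  then have "vpair u 1 = 0" by simp
  then have "u 1 = 0" "u 0 = 0"
    using norm_vpair_sq[of u 1] by (auto simp: shift_down_def add_nonneg_eq_0_iff)
  then have "shifted_J x u 0 = 0" by (simp add: shifted_J_eq shift_down_def)
  then show False by (simp add: u(2) \<delta>_def)
qed

end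

section \<open>An energy with bounded traces\<close>

lemma fib_trace_5_pos: "0 < fib_trace 5 k"
proof -
  have "4 \<le> fib_trace 5 k \<and> 4 \<le> fib_trace 5 (Suc k) \<and> fib_trace 5 k \<le> fib_trace 5 (Suc (Suc k)) \<and> fib_trace 5 (Suc k) \<le> fib_trace 5 (Suc (Suc k))"
  proof (induction k)
    case 0
    then show ?case using fib_trace_init[of 5] by (simp add: numeral_2_eq_2)
  next
    case (Suc k)
    then have "fib_trace 5 (Suc (Suc k)) * 4 \<le> fib_trace 5 (Suc (Suc k)) * fib_trace 5 (Suc k)" by (intro mult_left_mono) auto
    then show ?case using Suc unfolding fib_trace_rec[of 5 k] by (intro conjI) linarith+
  qed
  then show ?thesis by simp
qed

text \<open>At energy 0 the traces eventually repeat the signs minus, minus, plus with growing size;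
  the induction advances by one such block of three.\<close>

lemma fib_trace_0_neg: "fib_trace 0 (3 * m + 4) < 0"
proof -
  have "fib_trace 0 (3 * m + 4) \<le> -3 \<and> fib_trace 0 (3 * m + 5) \<le> fib_trace 0 (3 * m + 4) \<and> - fib_trace 0 (3 * m + 5) \<le> fib_trace 0 (3 * m + 6)"
  proof (induction m)
    case 0
    have x: "fib_trace 0 0 = 0" "fib_trace 0 (Suc 0) = -1" "fib_trace 0 (Suc (Suc 0)) = -2"
      using fib_trace_init[of 0] by (simp_all add: numeral_2_eq_2)
    show ?case by (simp add: numeral_eq_Suc fib_trace_rec x)
  next
    case (Suc m)
    define a b c d e f where "a = fib_trace 0 (3 * m + 4)" and "b = fib_trace 0 (3 * m + 5)" and "c = fib_trace 0 (3 * m + 6)"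
      and "d = fib_trace 0 (3 * m + 7)" and "e = fib_trace 0 (3 * m + 8)" and "f = fib_trace 0 (3 * m + 9)"
    have rec: "d = c * b - a" "e = d * c - b" "f = e * d - c"
      using fib_trace_rec[of 0 "3 * m + 4"] fib_trace_rec[of 0 "3 * m + 5"] fib_trace_rec[of 0 "3 * m + 6"]
      by (simp_all add: a_def b_def c_def d_def e_def f_def numeral_eq_Suc)
    have IH: "a \<le> -3" "b \<le> a" "-b \<le> c" using Suc by (simp_all add: a_def b_def c_def)
    have "c * b \<le> c * (-3)" using IH by (intro mult_left_mono) auto
    then have d: "d \<le> -2 * c" using IH rec by linarith
    have "d * c \<le> d * 3" using IH d by (intro mult_left_mono_neg) auto
    then have e: "e \<le> d" using IH rec d by linarith
    have "e * (-3) \<le> e * d" using IH d e by (intro mult_left_mono_neg) auto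
    then have "-e \<le> f" using IH rec d e by linarith
    moreover have "d \<le> -3" using d IH by linarith
    moreover have "3 * Suc m + 4 = 3 * m + 7" "3 * Suc m + 5 = 3 * m + 8" "3 * Suc m + 6 = 3 * m + 9" by simp_all
    ultimately show ?case using e by (simp only: d_def e_def f_def)
  qed
  then show ?thesis by simp
qed

lemma continuous_on_fib_trace: "continuous_on S (\<lambda>E. fib_trace E k)"
proof -
  have "continuous_on S (\<lambda>E. fib_trace E k) \<and> continuous_on S (\<lambda>E. fib_trace E (Suc k)) \<and> continuous_on S (\<lambda>E. fib_trace E (Suc (Suc k)))"
  proof (induction k)
    case 0
    have "fib_trace E (Suc (Suc 0)) = E * (E - 1) - 2" for E using fib_trace_init(3)[of E] by (simp add: numeral_2_eq_2)
    then show ?case by (auto simp: fib_trace_init intro!: continuous_intros)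
  next
    case (Suc k)
    then show ?case unfolding fib_trace_rec by (auto intro!: continuous_intros)
  qed
  then show ?thesis by simp
qed

text \<open>A zero of a late trace forces all traces at least two scales earlier to be bounded, and every third trace
  changes sign between the energies $0$ and $5$.\<close>
lemma ex_bounded_trace: "\<exists>E. \<bar>E\<bar> \<le> 5 \<and> (\<forall>i. \<bar>fib_trace E i\<bar> \<le> 128)"
proof -
  define F where "F k = {-5..5} \<inter> (\<Inter>i\<in>{..k}. {E. \<bar>fib_trace E i\<bar> \<le> 128})" for k :: nat
  have "\<Inter> (range F) \<noteq> {}"
  proof (rule compact_nest)
    have "closed {E. \<bar>fib_trace E i\<bar> \<le> 128}" for i
      by (intro closed_Collect_le continuous_on_rabs continuous_on_fib_trace continuous_on_const)
    then show "compact (F k)" for k unfolding F_def by (intro compact_Int_closed closed_INT ballI) auto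
    show "F k \<noteq> {}" for k
    proof -
      have "\<exists>E\<ge>0. E \<le> 5 \<and> fib_trace E (3 * k + 4) = 0"
        using fib_trace_0_neg[of k] fib_trace_5_pos[of "3 * k + 4"]
        by (intro IVT'[of "\<lambda>E. fib_trace E (3 * k + 4)"] continuous_on_fib_trace) auto
      then obtain E where E: "0 \<le> E" "E \<le> 5" "fib_trace E (3 * k + 4) = 0" by blast
      have "\<bar>fib_trace E i\<bar> \<le> 128" if "i \<le> k" for i
      proof (rule ccontr)
        assume "\<not> ?thesis"
        then have "\<bar>fib_trace E (3 * k + 4)\<bar> > 128"
          using E that fib_trace_escape[of 128 E i "3 * k + 4"] by auto
        with E show False by simp
      qed
      then have "E \<in> F k" using E by (auto simp: F_def)
      then show ?thesis by blast
    qed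
    show "F n \<subseteq> F m" if "m \<le> n" for m n using that by (force simp: F_def)
  qed
  then obtain E where E: "\<And>k. E \<in> F k" by blast
  have "\<bar>fib_trace E i\<bar> \<le> 128" for i using E[of i] by (auto simp: F_def)
  moreover have "\<bar>E\<bar> \<le> 5" using E[of 0] by (auto simp: F_def)
  ultimately show ?thesis by blast
qed

theorem theorem8p3:
  fixes \<theta> :: real
  assumes "0 \<le> \<theta>" and "\<theta> < 1"
  shows "(\<lambda>n. SUP x0\<in>jacobi_spectrum (\<lambda>_. 1) (fib_pot \<theta>).
            (opoly (\<lambda>_. 1) (fib_pot \<theta>) n x0)\<^sup>2 / CD_kernel (\<lambda>_. 1) (fib_pot \<theta>) n x0 x0)
         \<longlonglongrightarrow> 0"
proof (rule LIMSEQ_I)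
  fix r :: real assume r: "r > 0"
  define \<Sigma> where "\<Sigma> = jacobi_spectrum (\<lambda>_. 1) (fib_pot \<theta>)"
  define h where "h n y = (opoly (\<lambda>_. 1) (fib_pot \<theta>) n y)\<^sup>2 / CD_kernel (\<lambda>_. 1) (fib_pot \<theta>) n y y" for n y
  interpret b: bounded_potential "fib_pot \<theta>"
    by (rule bounded_potential_fib_pot)
  \<comment> \<open>This point makes the spectrum nonempty, and the nonnegative ratio at it bounds
    the supremum from below.\<close>
  obtain E where E: "\<bar>E\<bar> \<le> 5" "\<And>i. \<bar>fib_trace E i\<bar> \<le> 128" using ex_bounded_trace by blast
  have E\<Sigma>: "E \<in> \<Sigma>"
    unfolding \<Sigma>_def using E by (intro fib_jacobi.bounded_trace_in_spectrum) (auto simp: fib_jacobi_def)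
  obtain S where S: "33800 / r < real S" using reals_Archimedean2 by blast
  have "0 < real S" using S r by (meson divide_pos_pos less_trans zero_less_numeral)
  then have S0: "0 < S" by simp
  have le: "h n y \<le> 33800 / real S" if "n \<ge> 4 * fib (10 * S + 10)" "y \<in> \<Sigma>" for n y
  proof -
    interpret fib_jacobi \<theta> y
      using b.spectrum_bounded[of y] that(2) by unfold_locales (simp add: \<Sigma>_def)
    show ?thesis
      using spectrum_ratio_bound[of S n] that S0 by (simp add: h_def p_def \<Sigma>_def)
  qed
  have h0: "0 \<le> h n y" for n y
    unfolding h_def CD_kernel_def by (intro divide_nonneg_nonneg sum_nonneg) auto
  show "\<exists>no. \<forall>n\<ge>no. norm ((SUP x0\<in>jacobi_spectrum (\<lambda>_. 1) (fib_pot \<theta>).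
            (opoly (\<lambda>_. 1) (fib_pot \<theta>) n x0)\<^sup>2 / CD_kernel (\<lambda>_. 1) (fib_pot \<theta>) n x0 x0) - 0) < r"
    unfolding \<Sigma>_def[symmetric] h_def[symmetric]
  proof (intro exI allI impI)
    fix n assume n: "n \<ge> 4 * fib (10 * S + 10)"
    have "(SUP y\<in>\<Sigma>. h n y) \<le> 33800 / real S"
      using E\<Sigma> le[OF n] by (intro cSUP_least) auto
    moreover have "h n E \<le> (SUP y\<in>\<Sigma>. h n y)"
      using E\<Sigma> le[OF n] by (intro cSUP_upper) (auto simp: bdd_above_def)
    moreover have "33800 / real S < r" using S r S0 by (simp add: field_simps)
    ultimately show "norm ((SUP y\<in>\<Sigma>. h n y) - 0) < r" using h0[of n E] by simp
  qed
qed

end
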